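(* If $\{G_i: i\in I\}$ is a set of CAP groups, then $\prod_{i\in I} G_i$ is CAP.
   Context: All topological groups and spaces are Hausdorff; products of groups carry the product topology. For a topological group $G$, a $G$-flow is a (non-empty) compact Hausdorff space with a continuous left action of $G$; a subflow is a non-empty closed $G$-invariant subset; a flow is minimal if it has no proper subflow. For a $G$-flow $X$, $\mathrm{AP}_G(X)=\{x\in X:\overline{Gx}\text{ is minimal}\}$. $G$ is CAP if $\mathrm{AP}_G(X)$ is closed in $X$ for every $G$-flow $X$. *)

theory Defs
  imports "HOL-Analysis.Analysis" "HOL-Algebra.Group_Action" "HOL-Algebra.Product_Groups"
begin

text \<open>The notation of HOL-Algebra clashes with the topological closure operator.\<close>
no_notation eq_closure_of (\<open>closure'_of\<index>\<close>)

definition topological_group :: "('g, 'm) monoid_scheme \<Rightarrow> 'g topology \<Rightarrow> bool" where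
  "topological_group G T \<longleftrightarrow>
     group G \<and> topspace T = carrier G \<and> Hausdorff_space T \<and>
     continuous_map (prod_topology T T) T (\<lambda>(g, h). g \<otimes>\<^bsub>G\<^esub> h) \<and>
     continuous_map T T (\<lambda>g. inv\<^bsub>G\<^esub> g)"

definition G_flow ::
  "('g, 'm) monoid_scheme \<Rightarrow> 'g topology \<Rightarrow> 'x topology \<Rightarrow> ('g \<Rightarrow> 'x \<Rightarrow> 'x) \<Rightarrow> bool" where
  "G_flow G T X \<phi> \<longleftrightarrow>
     topspace X \<noteq> {} \<and> compact_space X \<and> Hausdorff_space X \<and>
     group_action G (topspace X) \<phi> \<and>
     continuous_map (prod_topology T X) X (\<lambda>(g, x). \<phi> g x)"

definition subflow ::
  "('g, 'm) monoid_scheme \<Rightarrow> 'x topology \<Rightarrow> ('g \<Rightarrow> 'x \<Rightarrow> 'x) \<Rightarrow> 'x set \<Rightarrow> bool" where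
  "subflow G X \<phi> Y \<longleftrightarrow>
     Y \<noteq> {} \<and> closedin X Y \<and> (\<forall>g \<in> carrier G. \<forall>y \<in> Y. \<phi> g y \<in> Y)"

definition minimal_flow ::
  "('g, 'm) monoid_scheme \<Rightarrow> 'x topology \<Rightarrow> ('g \<Rightarrow> 'x \<Rightarrow> 'x) \<Rightarrow> bool" where
  "minimal_flow G X \<phi> \<longleftrightarrow> \<not> (\<exists>Y. subflow G X \<phi> Y \<and> Y \<subset> topspace X)"

text \<open>Library actions are extensional on the space acted upon, so the action is restricted
  together with the topology when an orbit closure is regarded as a flow.\<close>

definition AP ::
  "('g, 'm) monoid_scheme \<Rightarrow> 'x topology \<Rightarrow> ('g \<Rightarrow> 'x \<Rightarrow> 'x) \<Rightarrow> 'x set" where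
  "AP G X \<phi> =
     {x \<in> topspace X.
        let C = X closure_of (orbit G \<phi> x)
        in minimal_flow G (subtopology X C) (\<lambda>g. restrict (\<phi> g) C)}"

text \<open>A definition cannot quantify over types, so CAP carries the type \<open>'x\<close> of points of
  the flows as a parameter. This affects strength only through the cardinality of \<open>'x\<close>:
  the lemma \<open>CAP_all_types\<close> below shows that the instance
  \<open>'x = 'g \<Rightarrow> real\<close> already implies the property for flows on any type whatsoever; that
  instance is therefore the full notion of a CAP group.\<close>

definition CAP :: "'x itself \<Rightarrow> ('g, 'm) monoid_scheme \<Rightarrow> 'g topology \<Rightarrow> bool" where
  "CAP (_ :: 'x itself) G T \<longleftrightarrow>
     topological_group G T \<and>
     (\<forall>(X :: 'x topology) \<phi>. G_flow G T X \<phi> \<longrightarrow> closedin X (AP G X \<phi>))"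

lemma G_flow_facts:
  assumes "G_flow G T X \<phi>" "topological_group G T"
  shows G_flow_group: "group G"
    and G_flow_closed: "\<And>g x. g \<in> carrier G \<Longrightarrow> x \<in> topspace X \<Longrightarrow> \<phi> g x \<in> topspace X"
    and G_flow_mult: "\<And>g h x. g \<in> carrier G \<Longrightarrow> h \<in> carrier G \<Longrightarrow> x \<in> topspace X
                        \<Longrightarrow> \<phi> (g \<otimes>\<^bsub>G\<^esub> h) x = \<phi> g (\<phi> h x)"
    and G_flow_one: "\<And>x. x \<in> topspace X \<Longrightarrow> \<phi> \<one>\<^bsub>G\<^esub> x = x"
    and G_flow_cont: "\<And>g. g \<in> carrier G \<Longrightarrow> continuous_map X X (\<phi> g)"
proof -
  have act: "group_action G (topspace X) \<phi>"
    and cont: "continuous_map (prod_topology T X) X (\<lambda>(g, x). \<phi> g x)"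
    and top: "topspace T = carrier G"
    using assms by (auto simp: G_flow_def topological_group_def)
  interpret group_action G "topspace X" \<phi> by (rule act)
  show "group G" using assms by (simp add: topological_group_def)
  show "\<phi> g x \<in> topspace X" if "g \<in> carrier G" "x \<in> topspace X" for g x
    using element_image that by blast
  show "\<phi> (g \<otimes>\<^bsub>G\<^esub> h) x = \<phi> g (\<phi> h x)"
    if "g \<in> carrier G" "h \<in> carrier G" "x \<in> topspace X" for g h x
    using composition_rule that by blast
  show "\<phi> \<one>\<^bsub>G\<^esub> x = x" if "x \<in> topspace X" for x
    using id_eq_one that by (metis restrict_apply')
  show "continuous_map X X (\<phi> g)" if "g \<in> carrier G" for g
  proof -
    have "continuous_map X (prod_topology T X) (\<lambda>x. (g, x))"
      using that top by (simp add: continuous_map_pairwise o_def)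
    from continuous_map_compose[OF this cont] show ?thesis by (simp add: o_def)
  qed
qed

lemma orbit_closure:
  assumes fl: "G_flow G T X \<phi>" and tg: "topological_group G T" and x: "x \<in> topspace X"
  shows orbit_closure_mem: "x \<in> X closure_of orbit G \<phi> x"
    and orbit_closure_subflow: "subflow G X \<phi> (X closure_of orbit G \<phi> x)"
    and orbit_closure_least: "\<And>Z. subflow G X \<phi> Z \<Longrightarrow> x \<in> Z \<Longrightarrow> X closure_of orbit G \<phi> x \<subseteq> Z"
proof -
  note facts = G_flow_facts[OF fl tg]
  interpret group G by (rule facts)
  have sub: "orbit G \<phi> x \<subseteq> topspace X"
    using facts(2) x by (auto simp: orbit_def)
  have "x \<in> orbit G \<phi> x"
    unfolding orbit_def using facts(4)[OF x, symmetric] one_closed by blast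
  then show mem: "x \<in> X closure_of orbit G \<phi> x"
    using closure_of_subset[OF sub] by blast
  have "\<phi> g y \<in> X closure_of orbit G \<phi> x"
    if g: "g \<in> carrier G" and y: "y \<in> X closure_of orbit G \<phi> x" for g y
  proof -
    have "\<phi> g ` (X closure_of orbit G \<phi> x) \<subseteq> X closure_of (\<phi> g ` orbit G \<phi> x)"
      using facts(5)[OF g] by (simp add: continuous_map_image_closure_subset)
    moreover have "\<phi> g ` orbit G \<phi> x \<subseteq> orbit G \<phi> x"
      using facts(3)[OF g _ x, symmetric] g by (auto simp: orbit_def)
    ultimately show ?thesis using y closure_of_mono by blast
  qed
  then show "subflow G X \<phi> (X closure_of orbit G \<phi> x)"
    using mem by (auto simp: subflow_def)
  show "X closure_of orbit G \<phi> x \<subseteq> Z" if "subflow G X \<phi> Z" "x \<in> Z" for Z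
    using that by (intro closure_of_minimal) (auto simp: subflow_def orbit_def)
qed

lemma mem_AP_iff:
  assumes fl: "G_flow G T X \<phi>" and tg: "topological_group G T"
  shows "x \<in> AP G X \<phi> \<longleftrightarrow>
    x \<in> topspace X \<and> (\<forall>Z. subflow G X \<phi> Z \<and> Z \<subseteq> X closure_of orbit G \<phi> x \<longrightarrow> x \<in> Z)"
proof (cases "x \<in> topspace X")
  case True
  define C where "C = X closure_of orbit G \<phi> x"
  have C: "closedin X C" "x \<in> C" "topspace (subtopology X C) = C"
    using orbit_closure_mem[OF fl tg True]
    using closure_of_subset_topspace[of X "orbit G \<phi> x"]
    by (auto simp: C_def topspace_subtopology_subset)
  have "subflow G (subtopology X C) (\<lambda>g. restrict (\<phi> g) C) Z \<longleftrightarrow> subflow G X \<phi> Z \<and> Z \<subseteq> C" for Z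
    using C by (auto simp: subflow_def closedin_closed_subtopology restrict_def subset_iff)
  then have "x \<in> AP G X \<phi> \<longleftrightarrow> (\<forall>Z. subflow G X \<phi> Z \<and> Z \<subseteq> C \<longrightarrow> \<not> Z \<subset> C)"
    using True C(3) by (auto simp: AP_def minimal_flow_def Let_def C_def)
  also have "\<dots> \<longleftrightarrow> (\<forall>Z. subflow G X \<phi> Z \<and> Z \<subseteq> C \<longrightarrow> x \<in> Z)"
    using orbit_closure_least[OF fl tg True] C(2) unfolding C_def by blast
  finally show ?thesis using True by (simp add: C_def)
qed (simp add: AP_def)

lemma factor_flow:
  assumes fl: "G_flow G T X \<phi>" and tg: "topological_group G T"
    and cf: "continuous_map X Y f" and surj: "f ` topspace X = topspace Y"
    and haus: "Hausdorff_space Y"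
    and ext: "\<And>g. g \<in> carrier G \<Longrightarrow> \<psi> g \<in> extensional (topspace Y)"
    and equiv: "\<And>g x. g \<in> carrier G \<Longrightarrow> x \<in> topspace X \<Longrightarrow> \<psi> g (f x) = f (\<phi> g x)"
  shows factor_flow_flow: "G_flow G T Y \<psi>"
    and factor_flow_AP: "f ` AP G X \<phi> \<subseteq> AP G Y \<psi>"
    and factor_flow_subflow: "\<And>Z. subflow G X \<phi> Z \<Longrightarrow> subflow G Y \<psi> (f ` Z)"
    and factor_flow_closure: "\<And>x. x \<in> topspace X \<Longrightarrow>
          Y closure_of orbit G \<psi> (f x) = f ` (X closure_of orbit G \<phi> x)"
proof -
  note facts = G_flow_facts[OF fl tg]
  interpret group G by (rule facts)
  have top: "topspace T = carrier G" using tg by (simp add: topological_group_def)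
  have comp: "compact_space X" "topspace X \<noteq> {}"
    and cont: "continuous_map (prod_topology T X) X (\<lambda>(g, x). \<phi> g x)"
    using fl by (auto simp: G_flow_def)
  have lift: "\<exists>x\<in>topspace X. y = f x" if "y \<in> topspace Y" for y
    using that unfolding surj[symmetric] by blast
  have mapsto: "\<psi> g y \<in> topspace Y" if "g \<in> carrier G" "y \<in> topspace Y" for g y
  proof -
    obtain x where "x \<in> topspace X" "y = f x" using lift \<open>y \<in> topspace Y\<close> by blast
    then have "\<psi> g y = f (\<phi> g x)" "\<phi> g x \<in> topspace X"
      using equiv[OF that(1)] facts(2)[OF that(1)] by simp_all
    then show ?thesis using surj by blast
  qed
  have mult: "\<psi> (g \<otimes>\<^bsub>G\<^esub> h) y = \<psi> g (\<psi> h y)"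
    if "g \<in> carrier G" "h \<in> carrier G" "y \<in> topspace Y" for g h y
  proof -
    obtain x where "x \<in> topspace X" "y = f x" using lift \<open>y \<in> topspace Y\<close> by blast
    then show ?thesis
      using that facts(2,3) by (simp add: equiv)
  qed
  have one: "\<psi> \<one>\<^bsub>G\<^esub> y = y" if "y \<in> topspace Y" for y
  proof -
    obtain x where "x \<in> topspace X" "y = f x" using lift \<open>y \<in> topspace Y\<close> by blast
    then show ?thesis using facts(4) by (simp add: equiv)
  qed
  have bij: "\<psi> g \<in> Bij (topspace Y)" if g: "g \<in> carrier G" for g
  proof -
    have "bij_betw (\<psi> g) (topspace Y) (topspace Y)"
    proof (rule bij_betwI[where g = "\<psi> (inv\<^bsub>G\<^esub> g)"])
      show "\<psi> (inv\<^bsub>G\<^esub> g) (\<psi> g x) = x" if "x \<in> topspace Y" for x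
        using mult[of "inv\<^bsub>G\<^esub> g" g x] one that g by simp
      show "\<psi> g (\<psi> (inv\<^bsub>G\<^esub> g) x) = x" if "x \<in> topspace Y" for x
        using mult[of g "inv\<^bsub>G\<^esub> g" x] one that g by simp
    qed (use g mapsto in auto)
    then show ?thesis using ext[OF g] by (simp add: Bij_def)
  qed
  have "\<psi> (g \<otimes>\<^bsub>G\<^esub> h) = compose (topspace Y) (\<psi> g) (\<psi> h)"
    if "g \<in> carrier G" "h \<in> carrier G" for g h
    using that ext mult by (intro extensionalityI[where A = "topspace Y"]) (auto simp: compose_def)
  then have "\<psi> \<in> hom G (BijGroup (topspace Y))"
    using bij by (auto simp: hom_def BijGroup_def)
  then have act: "group_action G (topspace Y) \<psi>"
    by (simp add: group_action_def group_hom_def group_hom_axioms_def group_BijGroup)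
  have pmap: "proper_map X Y f"
    using cf comp(1) haus by (simp add: continuous_imp_proper_map Hausdorff_imp_kc_space)
  have clm: "closed_map X Y f" using pmap by (simp add: proper_map_def)
  have "proper_map (prod_topology T X) (prod_topology T Y) (\<lambda>(g, x). (g, f x))"
    using pmap proper_map_prod[of T X T Y "\<lambda>g. g" f] proper_map_id[of T] by (simp add: id_def)
  moreover have "continuous_map (prod_topology T X) (prod_topology T Y) (\<lambda>(g, x). (g, f x))"
    using cf continuous_map_prod_top[of T X T Y "\<lambda>g. g" f] by simp
  moreover have "(\<lambda>(g, x). (g, f x)) ` topspace (prod_topology T X) = topspace (prod_topology T Y)"
    using surj by (force simp: image_iff)
  ultimately have quot: "quotient_map (prod_topology T X) (prod_topology T Y) (\<lambda>(g, x). (g, f x))"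
    by (simp add: continuous_closed_imp_quotient_map proper_map_def)
  have "continuous_map (prod_topology T X) Y (\<lambda>p. f ((\<lambda>(g, x). \<phi> g x) p))"
    using continuous_map_compose[OF cont cf] by (simp add: o_def)
  then have "continuous_map (prod_topology T X) Y ((\<lambda>(g, y). \<psi> g y) \<circ> (\<lambda>(g, x). (g, f x)))"
    by (rule continuous_map_eq) (auto simp: equiv top)
  then have "continuous_map (prod_topology T Y) Y (\<lambda>(g, y). \<psi> g y)"
    using continuous_compose_quotient_map[OF quot] by blast
  moreover have "compact_space Y"
    using image_compactin[of X "topspace X" Y f] cf comp(1) surj by (simp add: compact_space_def)
  ultimately show flY: "G_flow G T Y \<psi>"
    using act haus comp(2) surj by (auto simp: G_flow_def)
  show closure: "Y closure_of orbit G \<psi> (f x) = f ` (X closure_of orbit G \<phi> x)"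
    if x: "x \<in> topspace X" for x
  proof -
    have "orbit G \<psi> (f x) = f ` orbit G \<phi> x"
      using equiv[OF _ x] unfolding orbit_def by force
    moreover have "orbit G \<phi> x \<subseteq> topspace X"
      using facts(2) x by (auto simp: orbit_def)
    ultimately show ?thesis
      using continuous_map_image_closure_subset[OF cf, of "orbit G \<phi> x"] closed_map_closure_of_image[of X Y f] clm
      by (simp add: subset_antisym)
  qed
  show "subflow G Y \<psi> (f ` Z)" if "subflow G X \<phi> Z" for Z
    using that clm closedin_subset[of X Z] equiv
    by (auto simp: subflow_def closed_map_def subset_iff)
  show "f ` AP G X \<phi> \<subseteq> AP G Y \<psi>"
  proof clarify
    fix x assume xAP: "x \<in> AP G X \<phi>"
    then have x: "x \<in> topspace X" by (simp add: AP_def)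
    let ?C = "X closure_of orbit G \<phi> x"
    have "f x \<in> Z" if Z: "subflow G Y \<psi> Z" "Z \<subseteq> Y closure_of orbit G \<psi> (f x)" for Z
    proof -
      let ?W = "{y \<in> topspace X. f y \<in> Z} \<inter> ?C"
      have "closedin X ?W"
        using Z(1) cf by (intro closedin_Int) (auto simp: subflow_def intro: closedin_continuous_map_preimage)
      moreover have "?W \<noteq> {}"
      proof -
        obtain z where "z \<in> Z" using Z(1) by (auto simp: subflow_def)
        then obtain y where "y \<in> ?C" "f y = z" using Z(2) closure[OF x] by auto
        moreover have "y \<in> topspace X"
          using \<open>y \<in> ?C\<close> closure_of_subset_topspace by fast
        ultimately show ?thesis using \<open>z \<in> Z\<close> by auto
      qed
      moreover have "\<phi> g y \<in> ?W" if g: "g \<in> carrier G" and y: "y \<in> ?W" for g y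
      proof -
        have "\<phi> g y \<in> topspace X" "f (\<phi> g y) = \<psi> g (f y)"
          using facts(2) equiv g y by auto
        moreover have "\<psi> g (f y) \<in> Z" using Z(1) g y by (simp add: subflow_def)
        moreover have "\<phi> g y \<in> ?C"
          using orbit_closure_subflow[OF fl tg x] g y by (simp add: subflow_def)
        ultimately show ?thesis by simp
      qed
      ultimately have "subflow G X \<phi> ?W"
        by (simp only: subflow_def) blast
      then have "x \<in> ?W" using xAP mem_AP_iff[OF fl tg] by blast
      then show ?thesis by simp
    qed
    moreover have "f x \<in> topspace Y"
      unfolding surj[symmetric] using x by (rule imageI)
    ultimately show "f x \<in> AP G Y \<psi>"
      using mem_AP_iff[OF flY tg] by blast
  qed
qed

lemma CAP_all_types:
  fixes G :: "('g, 'm) monoid_scheme"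
  assumes cap: "CAP TYPE('g \<Rightarrow> real) G T"
  shows "CAP TYPE('x) G T"
proof -
  have tg: "topological_group G T" using cap by (simp add: CAP_def)
  have "x \<in> AP G X \<phi>"
    if fl: "G_flow G T X \<phi>" and xcl: "x \<in> X closure_of AP G X \<phi>" for X :: "'x topology" and \<phi> x
  proof (rule ccontr)
    assume "x \<notin> AP G X \<phi>"
    note facts = G_flow_facts[OF fl tg]
    interpret group G by (rule facts)
    have x: "x \<in> topspace X" using xcl closure_of_subset_topspace by fast
    obtain Z where Z: "subflow G X \<phi> Z" "Z \<subseteq> X closure_of orbit G \<phi> x" "x \<notin> Z"
      using \<open>x \<notin> AP G X \<phi>\<close> x mem_AP_iff[OF fl tg] by blast
    have Zcl: "closedin X Z" and Zsub: "Z \<subseteq> topspace X" and Zne: "Z \<noteq> {}"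
      using Z(1) closedin_subset by (auto simp: subflow_def)
    have norm: "normal_space X" and "closedin X {x}"
      using fl x by (auto simp: G_flow_def compact_Hausdorff_or_regular_imp_normal_space
          closedin_Hausdorff_singleton)
    then obtain u :: "'x \<Rightarrow> real" where u: "continuous_map X euclideanreal u" "u ` Z \<subseteq> {0}" "u ` {x} \<subseteq> {1}"
      using Urysohn_lemma_alt[OF norm Zcl \<open>closedin X {x}\<close>, of 0 1] Z(3) by (auto simp: disjnt_def)
    define f where "f y = (\<lambda>g\<in>carrier G. u (\<phi> g y))" for y
    define P where "P = product_topology (\<lambda>g :: 'g. euclideanreal) (carrier G)"
    define Y where "Y = subtopology P (f ` topspace X)"
    define \<psi> where "\<psi> h = (\<lambda>v\<in>f ` topspace X. \<lambda>g\<in>carrier G. v (g \<otimes>\<^bsub>G\<^esub> h) :: real)" for h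
    have "continuous_map X P f"
      using continuous_map_compose[OF facts(5) u(1)]
      by (auto simp: P_def f_def continuous_map_componentwise o_def)
    moreover have topY: "topspace Y = f ` topspace X"
      by (auto simp: Y_def P_def f_def)
    ultimately have cf: "continuous_map X Y f"
      by (simp add: Y_def continuous_map_in_subtopology)
    have haus: "Hausdorff_space Y"
      by (simp add: Y_def P_def Hausdorff_space_subtopology Hausdorff_space_product_topology)
    have ext: "\<psi> g \<in> extensional (topspace Y)" for g
      by (simp add: \<psi>_def topY)
    have equiv: "\<psi> h (f y) = f (\<phi> h y)" if "h \<in> carrier G" "y \<in> topspace X" for h y
    proof -
      have "\<psi> h (f y) = (\<lambda>g\<in>carrier G. f y (g \<otimes>\<^bsub>G\<^esub> h))"
        using that by (simp add: \<psi>_def)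
      also have "\<dots> = f (\<phi> h y)"
        using that facts(3) by (auto simp: f_def intro!: restrict_ext)
      finally show ?thesis .
    qed
    note factor = factor_flow[where \<psi> = \<psi>, OF fl tg cf topY[symmetric] haus ext equiv]
    have flY: "G_flow G T Y \<psi>"
      using factor(1) by blast
    then have "closedin Y (AP G Y \<psi>)"
      using cap unfolding CAP_def by blast
    moreover have "f x \<in> Y closure_of (f ` AP G X \<phi>)"
      using continuous_map_image_closure_subset[OF cf] xcl by blast
    ultimately have "f x \<in> AP G Y \<psi>"
      using factor(2) by (meson closure_of_minimal subsetD)
    moreover have "subflow G Y \<psi> (f ` Z)"
      using factor(3) Z(1) by blast
    moreover have "f ` Z \<subseteq> Y closure_of orbit G \<psi> (f x)"
      using factor(4) x Z(2) by blast
    ultimately have "f x \<in> f ` Z"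
      using mem_AP_iff[OF flY tg] by blast
    then obtain z where z: "z \<in> Z" "f x = f z" by blast
    have "f z \<one>\<^bsub>G\<^esub> = u z" "f x \<one>\<^bsub>G\<^esub> = u x"
      using facts(4) z(1) Zsub x by (auto simp: f_def)
    then show False using z u(2,3) by auto
  qed
  note mem = this
  have "closedin X (AP G X \<phi>)" if fl: "G_flow G T X \<phi>" for X :: "'x topology" and \<phi>
  proof -
    have "AP G X \<phi> \<subseteq> topspace X" unfolding AP_def by (rule Collect_restrict)
    moreover have "X closure_of AP G X \<phi> \<subseteq> AP G X \<phi>" using mem[OF fl] by blast
    ultimately show ?thesis by (simp add: closure_of_subset_eq[symmetric])
  qed
  then show ?thesis using tg by (simp add: CAP_def)
qed

end

theory Submission
  imports Defs
begin

text \<open>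
Call a point \<open>x\<close> of a compact space almost periodic for a family of maps if \<open>x\<close> lies in the orbit
closure of every point of its own orbit closure; for a flow this says that the orbit closure of
\<open>x\<close> is minimal. The proof rests on an equicontinuity property of CAP groups
(\<open>equicontinuous_on_minimal\<close>): if \<open>M\<close> is a minimal flow of a CAP group, \<open>Y\<close> another flow, \<open>\<Phi>\<close> any
set of equivariant continuous maps \<open>M \<rightarrow> Y\<close> and \<open>f\<close> a continuous real function on \<open>Y\<close>, then the
functions \<open>f \<circ> F\<close> with \<open>F \<in> \<Phi>\<close> are equicontinuous on \<open>M\<close>.

Suppose they are not equicontinuous at \<open>p\<close>. Compactness yields limits \<open>w\<close> of points \<open>F q\<close>, and
\<open>v\<close> of the corresponding points \<open>F p\<close>, as \<open>q\<close> tends to \<open>p\<close>, with \<open>f w\<close> far from \<open>f v\<close>. Every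
triple \<open>(q, F q, F' q)\<close> is almost periodic in \<open>M \<times> Y \<times> Y\<close>, being an image of a point of \<open>M\<close>, and
\<open>(p, w, v)\<close> is an iterated limit of such triples: \<open>q\<close> and \<open>F\<close> vary first, \<open>F'\<close> afterwards. So
it is almost periodic, because the group is CAP, and every point of its orbit is moved by one of
finitely many group elements to a triple \<open>(y, a, b)\<close> with \<open>f a\<close> far from \<open>f b\<close>. This is impossible as soon as the
functions \<open>f \<circ> F\<close> have jointly small oscillation on some nonempty open subset of every nonempty
open set, since \<open>f a\<close> is close to \<open>f b\<close> for every triple of the orbit that lies over such a set
(\<open>small_oscillation_imp_equicontinuous\<close>). If, on the other hand, the oscillation is large on all
open subsets of some open set, bump functions with disjoint supports can be cut out of the
functions \<open>f \<circ> F\<close>; the maxima of the first \<open>n\<close> of them do have locally small oscillation on a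
dense open set, but are not equicontinuous at a cluster point of the bumps, which contradicts the
case just treated (\<open>ex_small_oscillation\<close>).

Let now a CAP group \<open>G\<close> act on \<open>X\<close>, let a family \<open>H\<close> of maps commute with \<open>G\<close>, and let all points
be almost periodic for \<open>G\<close> and for \<open>H\<close>. By equicontinuity of \<open>H\<close> on the minimal set \<open>cl (G x)\<close>, a
point of \<open>cl (H G x)\<close> lies in \<open>cl (H m)\<close> for some \<open>m \<in> cl (G x)\<close>, and both of these steps can be
reversed. So all points are almost periodic for \<open>H\<close> and \<open>G\<close> together
(\<open>almost_periodic_commuting\<close>).

In a flow of a product of CAP groups, almost periodic points for the product are almost periodic
for each factor, since factors are normal (\<open>almost_periodic_normal\<close>). As factors are CAP, this
passes to the closure of the set of these points. There, induction gives almost periodicity for all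
finite subproducts, and a point that is almost periodic for all finite subproducts is almost
periodic for the whole product, because elements of the product close to the unit in finitely
many coordinates move points only slightly (\<open>almost_periodic_if_finite_support\<close>).
\<close>

section \<open>Orbit closures and almost periodic points\<close>

text \<open>The acting family is an arbitrary index set, so that the same notions apply to a group, to a
subgroup given as a subset of the carrier, and to pairs from two commuting families.\<close>
definition orbcl :: "'x topology \<Rightarrow> ('s \<Rightarrow> 'x \<Rightarrow> 'x) \<Rightarrow> 's set \<Rightarrow> 'x \<Rightarrow> 'x set" where
  "orbcl X \<phi> S x = X closure_of ((\<lambda>s. \<phi> s x) ` S)"

definition almost_periodic :: "'x topology \<Rightarrow> ('s \<Rightarrow> 'x \<Rightarrow> 'x) \<Rightarrow> 's set \<Rightarrow> 'x \<Rightarrow> bool" where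
  "almost_periodic X \<phi> S x \<longleftrightarrow>
     x \<in> topspace X \<and> (\<forall>z \<in> orbcl X \<phi> S x. x \<in> orbcl X \<phi> S z)"

locale monoid_action =
  fixes X :: "'x topology" and \<phi> :: "'s \<Rightarrow> 'x \<Rightarrow> 'x" and S :: "'s set"
  assumes act_continuous: "\<And>s. s \<in> S \<Longrightarrow> continuous_map X X (\<phi> s)"
    and act_compose: "\<And>s t. s \<in> S \<Longrightarrow> t \<in> S \<Longrightarrow>
          \<exists>r \<in> S. \<forall>x \<in> topspace X. \<phi> s (\<phi> t x) = \<phi> r x"
    and act_identity: "\<exists>e \<in> S. \<forall>x \<in> topspace X. \<phi> e x = x"
begin

lemma act_in: "s \<in> S \<Longrightarrow> x \<in> topspace X \<Longrightarrow> \<phi> s x \<in> topspace X"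
  using act_continuous continuous_map_image_subset_topspace by fastforce

lemma orbit_subset_orbcl:
  assumes "x \<in> topspace X" "s \<in> S"
  shows "\<phi> s x \<in> orbcl X \<phi> S x"
  unfolding orbcl_def
  using closure_of_subset[of "(\<lambda>s. \<phi> s x) ` S" X] assms act_in by blast

lemma orbcl_self: "x \<in> topspace X \<Longrightarrow> x \<in> orbcl X \<phi> S x"
  using act_identity orbit_subset_orbcl by metis

lemma orbcl_invariant:
  assumes x: "x \<in> topspace X" and y: "y \<in> orbcl X \<phi> S x" and s: "s \<in> S"
  shows "\<phi> s y \<in> orbcl X \<phi> S x"
proof -
  have "\<phi> s y \<in> X closure_of (\<phi> s ` (\<lambda>s. \<phi> s x) ` S)"
    using continuous_map_image_closure_subset[OF act_continuous[OF s]] y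
    unfolding orbcl_def by blast
  moreover have "\<phi> s ` (\<lambda>s. \<phi> s x) ` S \<subseteq> (\<lambda>s. \<phi> s x) ` S"
    using act_compose[OF s] x by fastforce
  ultimately show ?thesis
    unfolding orbcl_def using closure_of_mono by blast
qed

end

lemma orbcl_in_topspace: "orbcl X \<phi> S x \<subseteq> topspace X"
  by (simp add: orbcl_def closure_of_subset_topspace)

lemma closedin_orbcl [simp]: "closedin X (orbcl X \<phi> S x)"
  by (simp add: orbcl_def)

lemma orbcl_least:
  "closedin X C \<Longrightarrow> (\<And>s. s \<in> S \<Longrightarrow> \<phi> s x \<in> C) \<Longrightarrow> orbcl X \<phi> S x \<subseteq> C"
  unfolding orbcl_def by (intro closure_of_minimal) auto

lemma orbcl_cong: "(\<lambda>s. \<phi> s x) ` S = (\<lambda>t. \<psi> t x) ` R \<Longrightarrow> orbcl X \<phi> S x = orbcl X \<psi> R x"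
  by (simp add: orbcl_def)

lemma almost_periodic_cong:
  assumes "\<And>y. y \<in> topspace X \<Longrightarrow> orbcl X \<phi> S y = orbcl X \<psi> R y"
  shows "almost_periodic X \<phi> S x \<longleftrightarrow> almost_periodic X \<psi> R x"
proof (cases "x \<in> topspace X")
  case True
  have "(\<forall>z\<in>orbcl X \<psi> R x. x \<in> orbcl X \<phi> S z) \<longleftrightarrow> (\<forall>z\<in>orbcl X \<psi> R x. x \<in> orbcl X \<psi> R z)"
    using assms orbcl_in_topspace[of X \<psi> R x] by (intro ball_cong) auto
  then show ?thesis by (simp add: almost_periodic_def assms[OF True])
qed (simp add: almost_periodic_def)

lemma orbcl_subspace:
  assumes "closedin X Y" "\<And>s. s \<in> S \<Longrightarrow> \<phi> s x \<in> Y"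
  shows "orbcl (subtopology X Y) \<phi> S x = orbcl X \<phi> S x"
proof -
  have "Y \<inter> (\<lambda>s. \<phi> s x) ` S = (\<lambda>s. \<phi> s x) ` S" using assms(2) by blast
  then show ?thesis
    using orbcl_least[of X Y S \<phi> x] assms
    by (auto simp: orbcl_def closure_of_subtopology)
qed

lemma (in monoid_action) orbcl_trans:
  assumes "x \<in> topspace X" "y \<in> orbcl X \<phi> S x"
  shows "orbcl X \<phi> S y \<subseteq> orbcl X \<phi> S x"
  by (rule orbcl_least) (use assms orbcl_invariant in auto)

text \<open>By compactness \<open>F\<close> is a closed map. The index sets of the two families may differ; only the
orbits have to correspond.\<close>

lemma orbcl_image:
  assumes comp: "compact_space X" and haus: "Hausdorff_space Y"
    and F: "continuous_map X Y F"
    and sub: "\<And>s. s \<in> S \<Longrightarrow> \<phi> s x \<in> topspace X"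
    and eq: "F ` (\<lambda>s. \<phi> s x) ` S = (\<lambda>t. \<psi> t (F x)) ` R"
  shows "orbcl Y \<psi> R (F x) = F ` orbcl X \<phi> S x"
proof -
  have "closed_map X Y F" by (rule continuous_imp_closed_map[OF F comp haus])
  moreover have "(\<lambda>s. \<phi> s x) ` S \<subseteq> topspace X" using sub by blast
  ultimately have "Y closure_of (F ` (\<lambda>s. \<phi> s x) ` S) = F ` (X closure_of ((\<lambda>s. \<phi> s x) ` S))"
    using closed_map_closure_of_image[of X Y F] continuous_map_image_closure_subset[OF F]
    by (simp add: subset_antisym)
  then show ?thesis by (simp only: orbcl_def eq)
qed

lemma almost_periodic_image:
  assumes comp: "compact_space X" and haus: "Hausdorff_space Y"
    and F: "continuous_map X Y F"
    and sub: "\<And>s x. s \<in> S \<Longrightarrow> x \<in> topspace X \<Longrightarrow> \<phi> s x \<in> topspace X"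
    and eq: "\<And>x. x \<in> topspace X \<Longrightarrow> F ` (\<lambda>s. \<phi> s x) ` S = (\<lambda>t. \<psi> t (F x)) ` R"
    and ap: "almost_periodic X \<phi> S x"
  shows "almost_periodic Y \<psi> R (F x)"
proof -
  have x: "x \<in> topspace X" using ap by (simp add: almost_periodic_def)
  have img: "orbcl Y \<psi> R (F y) = F ` orbcl X \<phi> S y" if "y \<in> topspace X" for y
    by (rule orbcl_image[OF comp haus F]) (use sub eq that in auto)
  have "F x \<in> topspace Y" using F x continuous_map_image_subset_topspace by fastforce
  moreover have "F x \<in> orbcl Y \<psi> R z" if zR: "z \<in> orbcl Y \<psi> R (F x)" for z
  proof -
    obtain y where y: "y \<in> orbcl X \<phi> S x" "z = F y"
      using zR unfolding img[OF x] by blast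
    then have "x \<in> orbcl X \<phi> S y" using ap by (simp add: almost_periodic_def)
    moreover have "y \<in> topspace X" using y(1) orbcl_in_topspace by fastforce
    ultimately show ?thesis using img y(2) by blast
  qed
  ultimately show ?thesis by (simp add: almost_periodic_def)
qed

text \<open>A minimal closed invariant subset of \<open>C\<close> consists of almost periodic points. Zorn's lemma is
applied to the open complements of invariant closed sets, where chains have their union as upper
bound and compactness of \<open>C\<close> keeps the union from covering \<open>C\<close>.\<close>

lemma (in monoid_action) almost_periodic_exists:
  assumes comp: "compact_space X" and C: "closedin X C" "C \<noteq> {}"
    and inv: "\<And>s x. s \<in> S \<Longrightarrow> x \<in> C \<Longrightarrow> \<phi> s x \<in> C"
  shows "\<exists>x \<in> C. almost_periodic X \<phi> S x"
proof -
  define \<A> where "\<A> = {U. openin X U \<and> (\<exists>x\<in>C. x \<notin> U) \<and> (\<forall>s\<in>S. \<forall>x \<in> C - U. \<phi> s x \<in> C - U)}"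
  have "\<exists>M\<in>\<A>. \<forall>U\<in>\<A>. M \<subseteq> U \<longrightarrow> U = M"
  proof (rule subset_Zorn_nonempty)
    have "{} \<in> \<A>" using C(2) inv by (auto simp: \<A>_def)
    then show "\<A> \<noteq> {}" by blast
    fix \<C> assume ne: "\<C> \<noteq> {}" and ch: "subset.chain \<A> \<C>"
    then have sub: "\<C> \<subseteq> \<A>"
      by (auto simp: subset.chain_def)
    have "\<not> C \<subseteq> \<Union>\<C>"
    proof
      assume cov: "C \<subseteq> \<Union>\<C>"
      have "compactin X C" using closedin_compact_space comp C(1) by blast
      moreover have "\<And>U. U \<in> \<C> \<Longrightarrow> openin X U" using sub by (auto simp: \<A>_def)
      ultimately obtain \<F> where F: "finite \<F>" "\<F> \<subseteq> \<C>" "C \<subseteq> \<Union>\<F>"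
        using cov by (meson compactinD)
      have "\<F> \<noteq> {}" using F(3) C(2) by blast
      then have "\<Union>\<F> \<in> \<F>"
        using Union_in_chain[of \<F> \<A>] F(1,2) ch unfolding subset.chain_def by blast
      then show False using F(2,3) sub by (auto simp: \<A>_def)
    qed
    moreover have "openin X (\<Union>\<C>)" using sub by (auto simp: \<A>_def)
    moreover have "\<phi> s x \<in> C - \<Union>\<C>" if "s \<in> S" "x \<in> C - \<Union>\<C>" for s x
      using that inv sub unfolding \<A>_def by blast
    ultimately show "\<Union>\<C> \<in> \<A>" by (auto simp: \<A>_def)
  qed
  then obtain M where M: "M \<in> \<A>" and max: "\<And>U. U \<in> \<A> \<Longrightarrow> M \<subseteq> U \<Longrightarrow> U = M" by blast
  define Z where "Z = C - M"
  have Z: "closedin X Z" "Z \<noteq> {}" "\<And>s x. s \<in> S \<Longrightarrow> x \<in> Z \<Longrightarrow> \<phi> s x \<in> Z"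
    using M C(1) by (auto simp: \<A>_def Z_def)
  have Zsub: "Z \<subseteq> topspace X" using Z(1) closedin_subset by blast
  have whole: "Z \<subseteq> orbcl X \<phi> S z" if z: "z \<in> Z" for z
  proof -
    let ?U = "topspace X - orbcl X \<phi> S z"
    have zt: "z \<in> topspace X" using z Zsub by blast
    have sub: "orbcl X \<phi> S z \<subseteq> Z" by (rule orbcl_least) (use Z z in auto)
    have CU: "C - ?U = orbcl X \<phi> S z"
      using sub orbcl_in_topspace[of X \<phi> S z] closedin_subset[OF C(1)] by (auto simp: Z_def)
    have "z \<in> C - ?U" using orbcl_self[OF zt] CU by simp
    moreover have "openin X ?U" by (rule openin_diff) auto
    ultimately have "?U \<in> \<A>"
      using orbcl_invariant[OF zt] CU unfolding \<A>_def by blast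
    moreover have "M \<subseteq> ?U"
      using M sub openin_subset[of X M] by (auto simp: \<A>_def Z_def)
    ultimately have "?U = M" using max by blast
    then show ?thesis using CU by (simp add: Z_def)
  qed
  obtain z where z: "z \<in> Z" using Z(2) by blast
  have "orbcl X \<phi> S z \<subseteq> Z" by (rule orbcl_least) (use Z z in auto)
  then have "almost_periodic X \<phi> S z"
    using whole z Zsub by (auto simp: almost_periodic_def)
  then show ?thesis using z by (auto simp: Z_def)
qed

section \<open>Compact actions of topological groups\<close>

text \<open>A flow, except that the space may be empty and that the maps may take any value outside the space.
The second point lets subspaces, products and subgroups inherit the action without restricting
it.\<close>

locale compact_action =
  fixes G :: "('g, 'm) monoid_scheme" and T :: "'g topology"
    and X :: "'x topology" and \<phi> :: "'g \<Rightarrow> 'x \<Rightarrow> 'x"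
  assumes topological_group: "topological_group G T"
    and compact: "compact_space X"
    and Hausdorff: "Hausdorff_space X"
    and jointly_continuous: "continuous_map (prod_topology T X) X (\<lambda>(g, x). \<phi> g x)"
    and act_mult: "\<And>g h x. g \<in> carrier G \<Longrightarrow> h \<in> carrier G \<Longrightarrow> x \<in> topspace X \<Longrightarrow>
          \<phi> (g \<otimes>\<^bsub>G\<^esub> h) x = \<phi> g (\<phi> h x)"
    and act_one: "\<And>x. x \<in> topspace X \<Longrightarrow> \<phi> \<one>\<^bsub>G\<^esub> x = x"
begin

lemma group: "group G" and topspace_group: "topspace T = carrier G"
  using topological_group by (auto simp: topological_group_def)

sublocale group G by (rule group)

sublocale monoid_action X \<phi> "carrier G"
proof
  fix g assume g: "g \<in> carrier G"
  have "continuous_map X (prod_topology T X) (\<lambda>x. (g, x))"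
    using g topspace_group by (simp add: continuous_map_pairwise o_def)
  from continuous_map_compose[OF this jointly_continuous]
  show "continuous_map X X (\<phi> g)" by (simp add: o_def)
next
  fix g h assume "g \<in> carrier G" "h \<in> carrier G"
  then show "\<exists>r\<in>carrier G. \<forall>x\<in>topspace X. \<phi> g (\<phi> h x) = \<phi> r x"
    by (intro bexI[of _ "g \<otimes>\<^bsub>G\<^esub> h"]) (auto simp: act_mult)
next
  show "\<exists>e\<in>carrier G. \<forall>x\<in>topspace X. \<phi> e x = x"
    using act_one by blast
qed

lemma act_inverse:
  assumes "g \<in> carrier G" "x \<in> topspace X"
  shows "\<phi> (inv\<^bsub>G\<^esub> g) (\<phi> g x) = x" "\<phi> g (\<phi> (inv\<^bsub>G\<^esub> g) x) = x"
  using assms by (simp_all flip: act_mult add: act_one)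

lemma subspace:
  assumes Y: "closedin X Y" and inv: "\<And>g y. g \<in> carrier G \<Longrightarrow> y \<in> Y \<Longrightarrow> \<phi> g y \<in> Y"
  shows "compact_action G T (subtopology X Y) \<phi>"
proof
  have Ysub: "Y \<subseteq> topspace X" using Y closedin_subset by blast
  show "topological_group G T" by (rule topological_group)
  show "compact_space (subtopology X Y)"
    using Y compact closedin_compact_space compact_space_subtopology by blast
  show "Hausdorff_space (subtopology X Y)" using Hausdorff Hausdorff_space_subtopology by blast
  have eq: "prod_topology T (subtopology X Y) = subtopology (prod_topology T X) (topspace T \<times> Y)"
    by (simp add: prod_topology_subtopology)
  show "continuous_map (prod_topology T (subtopology X Y)) (subtopology X Y) (\<lambda>(g, x). \<phi> g x)"
    unfolding continuous_map_in_subtopology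
  proof
    show "continuous_map (prod_topology T (subtopology X Y)) X (\<lambda>(g, x). \<phi> g x)"
      unfolding eq by (rule continuous_map_from_subtopology[OF jointly_continuous])
    show "(\<lambda>(g, x). \<phi> g x) \<in> topspace (prod_topology T (subtopology X Y)) \<rightarrow> Y"
      using inv topspace_group by auto
  qed
qed (use act_mult act_one in auto)

end

lemma compact_action_G_flow:
  assumes "G_flow G T X \<phi>" "topological_group G T"
  shows "compact_action G T X \<phi>"
  using assms G_flow_mult[OF assms] G_flow_one[OF assms]
  by (simp add: compact_action_def G_flow_def)

text \<open>The smallest subflow containing a point is its orbit closure, so quantifying over the subflows of
\<open>cl (G x)\<close> amounts to quantifying over its points.\<close>

lemma AP_eq_almost_periodic:
  assumes fl: "G_flow G T X \<phi>" and tg: "topological_group G T"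
  shows "AP G X \<phi> = {x. almost_periodic X \<phi> (carrier G) x}"
proof (rule Set.set_eqI)
  fix x
  interpret compact_action G T X \<phi> using fl tg by (rule compact_action_G_flow)
  have orb: "X closure_of orbit G \<phi> y = orbcl X \<phi> (carrier G) y" for y
    by (simp add: orbit_def orbcl_def Setcompr_eq_image)
  show "x \<in> AP G X \<phi> \<longleftrightarrow> x \<in> {x. almost_periodic X \<phi> (carrier G) x}"
  proof (cases "x \<in> topspace X")
    case x: True
    have "(\<forall>Z. subflow G X \<phi> Z \<and> Z \<subseteq> orbcl X \<phi> (carrier G) x \<longrightarrow> x \<in> Z)
      \<longleftrightarrow> (\<forall>z \<in> orbcl X \<phi> (carrier G) x. x \<in> orbcl X \<phi> (carrier G) z)" (is "?L \<longleftrightarrow> ?R")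
    proof
      assume L: ?L
      show ?R
      proof
        fix z assume z: "z \<in> orbcl X \<phi> (carrier G) x"
        then have zt: "z \<in> topspace X" using orbcl_in_topspace by fastforce
        show "x \<in> orbcl X \<phi> (carrier G) z"
          using L orbit_closure_subflow[OF fl tg zt] orbcl_trans[OF x z] orb by simp
      qed
    next
      assume R: ?R
      show ?L
      proof (intro allI impI)
        fix Z assume Z: "subflow G X \<phi> Z \<and> Z \<subseteq> orbcl X \<phi> (carrier G) x"
        then obtain z where z: "z \<in> Z" by (auto simp: subflow_def)
        then have zt: "z \<in> topspace X" using Z orbcl_in_topspace by fastforce
        have "orbcl X \<phi> (carrier G) z \<subseteq> Z"
          using orbit_closure_least[OF fl tg zt, of Z] Z z orb by simp
        then show "x \<in> Z" using R Z z by blast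
      qed
    qed
    then show ?thesis
      using x orb by (simp add: mem_AP_iff[OF fl tg] almost_periodic_def)
  qed (simp add: AP_def almost_periodic_def)
qed

text \<open>The defining property of CAP groups, for the more permissive notion of action and for spaces of
any type.\<close>

lemma (in compact_action) closedin_almost_periodic:
  assumes cap: "CAP TYPE('g \<Rightarrow> real) G T"
  shows "closedin X {x. almost_periodic X \<phi> (carrier G) x}"
proof (cases "topspace X = {}")
  case True
  then show ?thesis by (simp add: almost_periodic_def)
next
  case False
  define \<psi> where "\<psi> g = restrict (\<phi> g) (topspace X)" for g
  have bij: "\<psi> g \<in> Bij (topspace X)" if g: "g \<in> carrier G" for g
  proof -
    have "bij_betw (\<phi> g) (topspace X) (topspace X)"
      by (rule bij_betwI[where g = "\<phi> (inv\<^bsub>G\<^esub> g)"]) (use g act_in act_inverse in auto)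
    then show ?thesis by (simp add: Bij_def \<psi>_def)
  qed
  have "\<psi> (g \<otimes>\<^bsub>G\<^esub> h) = compose (topspace X) (\<psi> g) (\<psi> h)"
    if "g \<in> carrier G" "h \<in> carrier G" for g h
    using that by (auto simp: \<psi>_def compose_def act_mult act_in)
  then have "\<psi> \<in> hom G (BijGroup (topspace X))"
    using bij by (auto simp: hom_def BijGroup_def)
  then have act: "group_action G (topspace X) \<psi>"
    by (simp add: group_action_def group_hom_def group_hom_axioms_def group_BijGroup group)
  have "continuous_map (prod_topology T X) X (\<lambda>(g, x). \<psi> g x)"
    by (rule continuous_map_eq[OF jointly_continuous]) (auto simp: \<psi>_def)
  then have fl: "G_flow G T X \<psi>"
    using False compact Hausdorff act by (simp add: G_flow_def)
  have "almost_periodic X \<psi> (carrier G) x \<longleftrightarrow> almost_periodic X \<phi> (carrier G) x" for x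
    by (rule almost_periodic_cong) (simp add: orbcl_def \<psi>_def)
  then have "AP G X \<psi> = {x. almost_periodic X \<phi> (carrier G) x}"
    using AP_eq_almost_periodic[OF fl topological_group] by simp
  moreover have "closedin X (AP G X \<psi>)"
    using CAP_all_types[OF cap] fl unfolding CAP_def by blast
  ultimately show ?thesis by simp
qed

lemma directed_family_cluster_point:
  assumes comp: "compact_space X" and ne: "I \<noteq> {}"
    and A: "\<And>i. i \<in> I \<Longrightarrow> A i \<noteq> {} \<and> A i \<subseteq> topspace X"
    and dir: "\<And>i j. i \<in> I \<Longrightarrow> j \<in> I \<Longrightarrow> \<exists>k \<in> I. A k \<subseteq> A i \<inter> A j"
  shows "\<exists>c \<in> topspace X. \<forall>i \<in> I. c \<in> X closure_of A i"
proof -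
  have dirfin: "\<exists>k \<in> I. \<forall>j \<in> J. A k \<subseteq> A j" if "finite J" "J \<subseteq> I" for J
    using that
  proof (induction J rule: finite_induct)
    case empty
    then show ?case using ne by blast
  next
    case (insert i J)
    then obtain k where k: "k \<in> I" "\<forall>j \<in> J. A k \<subseteq> A j" by auto
    then obtain l where "l \<in> I" "A l \<subseteq> A i \<inter> A k" using dir[of i k] insert.prems by auto
    then show ?case using k by (intro bexI[of _ l]) auto
  qed
  have "\<Inter>((\<lambda>i. X closure_of A i) ` I) \<noteq> {}"
  proof (rule compact_space_fip[THEN iffD1, OF comp, rule_format])
    show "(\<forall>C\<in>(\<lambda>i. X closure_of A i) ` I. closedin X C) \<and>
      (\<forall>\<F>. finite \<F> \<and> \<F> \<subseteq> (\<lambda>i. X closure_of A i) ` I \<longrightarrow> \<Inter>\<F> \<noteq> {})"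
    proof (intro conjI allI impI ballI)
      fix \<F> assume "finite \<F> \<and> \<F> \<subseteq> (\<lambda>i. X closure_of A i) ` I"
      then obtain J where J: "finite J" "J \<subseteq> I" "\<F> = (\<lambda>i. X closure_of A i) ` J"
        by (meson finite_subset_image)
      then obtain k where k: "k \<in> I" "\<forall>j \<in> J. A k \<subseteq> A j" using dirfin by blast
      then obtain a where "a \<in> A k" using A by blast
      then have "a \<in> X closure_of A j" if "j \<in> J" for j
        using k that A J(2) closure_of_subset[of "A j" X] by blast
      then show "\<Inter>\<F> \<noteq> {}" using J(3) by blast
    qed auto
  qed
  then obtain c where "c \<in> \<Inter>((\<lambda>i. X closure_of A i) ` I)" by blast
  then have "\<forall>i \<in> I. c \<in> X closure_of A i" by blast
  moreover have "c \<in> topspace X" using calculation ne closure_of_subset_topspace by fastforce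
  ultimately show ?thesis by blast
qed

lemma compact_action_prod:
  assumes "compact_action G T X \<phi>" "compact_action G T Y \<psi>"
  shows "compact_action G T (prod_topology X Y) (\<lambda>g z. (\<phi> g (fst z), \<psi> g (snd z)))"
proof -
  interpret X: compact_action G T X \<phi> by fact
  interpret Y: compact_action G T Y \<psi> by fact
  let ?P = "prod_topology T (prod_topology X Y)"
  have "continuous_map ?P (prod_topology T X) (\<lambda>p. (fst p, fst (snd p)))"
    "continuous_map ?P (prod_topology T Y) (\<lambda>p. (fst p, snd (snd p)))"
    unfolding continuous_map_paired
    by (intro conjI continuous_map_fst continuous_map_fst_of continuous_map_snd_of
        continuous_map_compose[OF continuous_map_snd, unfolded o_def]
        continuous_map_id[unfolded id_def])+
  from continuous_map_compose[OF this(1) X.jointly_continuous]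
    continuous_map_compose[OF this(2) Y.jointly_continuous]
  have "continuous_map ?P (prod_topology X Y) (\<lambda>p. (\<phi> (fst p) (fst (snd p)), \<psi> (fst p) (snd (snd p))))"
    by (simp add: continuous_map_paired o_def case_prod_unfold)
  then show ?thesis
    using X.compact Y.compact X.Hausdorff Y.Hausdorff
    by unfold_locales
      (auto simp: X.topological_group compact_space_prod_topology Hausdorff_space_prod_topology
        X.act_mult Y.act_mult X.act_one Y.act_one case_prod_unfold)
qed

section \<open>Equicontinuity on minimal flows of CAP groups\<close>

text \<open>Here the CAP property is used. A failure of equicontinuity at \<open>p\<close> produces an almost periodic
point \<open>(p, w, v)\<close> of \<open>M \<times> Y \<times> Y\<close> with \<open>f w\<close> at least \<open>\<delta>\<close> away from \<open>f v\<close>. By almost periodicity the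
orbit returns to the region where the two values differ by more than \<open>\<epsilon>\<close>, within a finite set \<open>L\<close> of
group elements. But some orbit point lies over an open set all of whose translates by \<open>L\<close> lie in
sets of oscillation at most \<open>\<epsilon>\<close>.\<close>

lemma small_oscillation_imp_equicontinuous:
  fixes G :: "('g, 'm) monoid_scheme" and f :: "'y \<Rightarrow> real"
  assumes cap: "CAP TYPE('g \<Rightarrow> real) G T"
    and M: "compact_action G T M \<phi>" and Y: "compact_action G T Y \<psi>"
    and minimal: "\<And>x. x \<in> topspace M \<Longrightarrow> orbcl M \<phi> (carrier G) x = topspace M"
    and cont: "\<And>F. F \<in> \<Phi> \<Longrightarrow> continuous_map M Y F"
    and equiv: "\<And>F g x. F \<in> \<Phi> \<Longrightarrow> g \<in> carrier G \<Longrightarrow> x \<in> topspace M \<Longrightarrow> F (\<phi> g x) = \<psi> g (F x)"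
    and f: "continuous_map Y euclideanreal f"
    and small: "\<And>V. openin M V \<Longrightarrow> V \<noteq> {} \<Longrightarrow>
      \<exists>W. openin M W \<and> W \<noteq> {} \<and> W \<subseteq> V \<and> (\<forall>F\<in>\<Phi>. \<forall>a\<in>W. \<forall>b\<in>W. \<bar>f (F a) - f (F b)\<bar> \<le> \<epsilon>)"
    and less: "\<epsilon> < \<delta>" and p: "p \<in> topspace M"
  shows "\<exists>V. openin M V \<and> p \<in> V \<and> (\<forall>F\<in>\<Phi>. \<forall>q\<in>V. \<bar>f (F q) - f (F p)\<bar> < \<delta>)"
proof (rule ccontr)
  assume neg: "\<not> ?thesis"
  interpret M: compact_action G T M \<phi> by (rule M)
  interpret Y: compact_action G T Y \<psi> by (rule Y)
  let ?YY = "prod_topology Y Y" and ?K = "carrier G"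
  \<comment> \<open>The pairs that witness the failure of equicontinuity inside \<open>V\<close>; they cluster at \<open>(w, v)\<close>.\<close>
  define B where "B V = {(F q, F p) | F q. F \<in> \<Phi> \<and> q \<in> V \<and> \<delta> \<le> \<bar>f (F q) - f (F p)\<bar>}" for V
  define nhd where "nhd = {V. openin M V \<and> p \<in> V}"
  have in_Y: "F x \<in> topspace Y" if "F \<in> \<Phi>" "x \<in> topspace M" for F x
    using cont[OF that(1)] that(2) continuous_map_image_subset_topspace by fastforce
  have B_sub: "B V \<subseteq> topspace ?YY" if "V \<subseteq> topspace M" for V
    using that in_Y p by (auto simp: B_def)
  have "\<exists>c \<in> topspace ?YY. \<forall>V \<in> nhd. c \<in> ?YY closure_of B V"
  proof (rule directed_family_cluster_point)
    show "compact_space ?YY" using Y.compact by (simp add: compact_space_prod_topology)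
    show "nhd \<noteq> {}" using p by (auto simp: nhd_def)
    show "B V \<noteq> {} \<and> B V \<subseteq> topspace ?YY" if V: "V \<in> nhd" for V
    proof
      have "openin M V" "p \<in> V" using V by (auto simp: nhd_def)
      then show "B V \<subseteq> topspace ?YY" using B_sub openin_subset by blast
      obtain F q where "F \<in> \<Phi>" "q \<in> V" "\<delta> \<le> \<bar>f (F q) - f (F p)\<bar>"
        using neg \<open>openin M V\<close> \<open>p \<in> V\<close> by (meson not_le)
      then show "B V \<noteq> {}" by (auto simp: B_def)
    qed
    show "\<exists>W \<in> nhd. B W \<subseteq> B U \<inter> B V" if "U \<in> nhd" "V \<in> nhd" for U V
      using that by (intro bexI[of _ "U \<inter> V"]) (auto simp: B_def nhd_def)
  qed
  then obtain w v where wv: "w \<in> topspace Y" "v \<in> topspace Y"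
    "\<And>V. V \<in> nhd \<Longrightarrow> (w, v) \<in> ?YY closure_of B V" by auto
  have meets: "\<exists>F\<in>\<Phi>. \<exists>q\<in>V. F q \<in> N \<and> F p \<in> N'"
    if V: "V \<in> nhd" and N: "openin Y N" "w \<in> N" "openin Y N'" "v \<in> N'" for V N N'
  proof -
    have "openin ?YY (N \<times> N')" "(w, v) \<in> N \<times> N'" using N by (auto simp: openin_prod_Times_iff)
    then obtain c where "c \<in> B V" "c \<in> N \<times> N'"
      using wv(3)[OF V] unfolding in_closure_of by meson
    then show ?thesis by (auto simp: B_def)
  qed
  have D: "continuous_map ?YY euclideanreal (\<lambda>c. \<bar>f (fst c) - f (snd c)\<bar>)"
    by (intro continuous_map_real_abs continuous_map_diff)
      (use f continuous_map_compose[of ?YY Y fst euclideanreal f] continuous_map_fst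
         continuous_map_compose[of ?YY Y snd euclideanreal f] continuous_map_snd
       in \<open>auto simp: o_def\<close>)
  have far: "\<delta> \<le> \<bar>f w - f v\<bar>"
  proof -
    have "closedin ?YY {c \<in> topspace ?YY. \<bar>f (fst c) - f (snd c)\<bar> \<in> {\<delta>..}}"
      by (rule closedin_continuous_map_preimage[OF D]) simp
    moreover have "B (topspace M) \<subseteq> {c \<in> topspace ?YY. \<bar>f (fst c) - f (snd c)\<bar> \<in> {\<delta>..}}"
      using B_sub[of "topspace M"] by (auto simp: B_def)
    ultimately have "?YY closure_of B (topspace M) \<subseteq> {c \<in> topspace ?YY. \<bar>f (fst c) - f (snd c)\<bar> \<in> {\<delta>..}}"
      by (rule closure_of_minimal[rotated])
    then show ?thesis using wv(3)[of "topspace M"] p by (auto simp: nhd_def)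
  qed
  \<comment> \<open>When \<open>g p\<close> lies in a set of small oscillation, so does \<open>g q\<close> for \<open>q\<close> near \<open>p\<close>, and the
    resulting bound survives in the limit.\<close>
  have near: "\<bar>f (\<psi> g w) - f (\<psi> g v)\<bar> \<le> \<epsilon>"
    if g: "g \<in> ?K" and W: "openin M W" "\<phi> g p \<in> W"
      "\<forall>F\<in>\<Phi>. \<forall>a\<in>W. \<forall>b\<in>W. \<bar>f (F a) - f (F b)\<bar> \<le> \<epsilon>" for g W
  proof -
    let ?V = "{q \<in> topspace M. \<phi> g q \<in> W}"
    let ?C = "{c \<in> topspace ?YY. \<bar>f (\<psi> g (fst c)) - f (\<psi> g (snd c))\<bar> \<in> {..\<epsilon>}}"
    have "continuous_map ?YY ?YY (\<lambda>c. (\<psi> g (fst c), \<psi> g (snd c)))"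
      using continuous_map_compose[OF continuous_map_fst Y.act_continuous[OF g]]
        continuous_map_compose[OF continuous_map_snd Y.act_continuous[OF g]]
      unfolding continuous_map_paired o_def by blast
    from continuous_map_compose[OF this D]
    have "closedin ?YY ?C"
      by (intro closedin_continuous_map_preimage[of ?YY euclideanreal]) (auto simp: o_def)
    moreover have "B ?V \<subseteq> ?C"
    proof
      fix c assume c: "c \<in> B ?V"
      then obtain F q where F: "F \<in> \<Phi>" "q \<in> topspace M" "\<phi> g q \<in> W" "c = (F q, F p)"
        by (auto simp: B_def)
      have "\<bar>f (F (\<phi> g q)) - f (F (\<phi> g p))\<bar> \<le> \<epsilon>" using W F by blast
      then show "c \<in> ?C" using F equiv g p in_Y by simp
    qed
    ultimately have "?YY closure_of B ?V \<subseteq> ?C" by (rule closure_of_minimal[rotated])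
    moreover have "?V \<in> nhd"
      using openin_continuous_map_preimage[OF M.act_continuous[OF g] W(1)] p W(2)
      by (simp add: nhd_def)
    ultimately show ?thesis using wv(3) by fastforce
  qed
  let ?P = "prod_topology M ?YY"
  define \<rho> where "\<rho> = (\<lambda>g z. (\<phi> g (fst z), \<psi> g (fst (snd z)), \<psi> g (snd (snd z))))"
  have "compact_action G T ?P \<rho>"
    using compact_action_prod[OF M compact_action_prod[OF Y Y]] by (simp add: \<rho>_def)
  then interpret P: compact_action G T ?P \<rho> .
  define A where "A = {z. almost_periodic ?P \<rho> ?K z}"
  have closed_A: "closedin ?P A" unfolding A_def by (rule P.closedin_almost_periodic[OF cap])
  have closure_A: "z \<in> A" if "z \<in> topspace ?P" "\<And>W. openin ?P W \<Longrightarrow> z \<in> W \<Longrightarrow> \<exists>y \<in> A. y \<in> W" for z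
  proof -
    have "z \<in> ?P closure_of A" using that unfolding in_closure_of by blast
    then show ?thesis by (simp add: closure_of_closedin[OF closed_A])
  qed
  have apM: "almost_periodic M \<phi> ?K q" if "q \<in> topspace M" for q
    using that minimal by (auto simp: almost_periodic_def)
  \<comment> \<open>The iterated limit: first \<open>F q\<close> tends to \<open>w\<close> with \<open>F'\<close> fixed, then \<open>F' p\<close> tends to \<open>v\<close>.\<close>
  have A1: "(q, F q, F' q) \<in> A" if "F \<in> \<Phi>" "F' \<in> \<Phi>" "q \<in> topspace M" for F F' q
  proof -
    have "almost_periodic ?P \<rho> ?K ((\<lambda>q. (q, F q, F' q)) q)"
    proof (rule almost_periodic_image[OF M.compact P.Hausdorff _ _ _ apM])
      show "continuous_map M ?P (\<lambda>q. (q, F q, F' q))"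
        using that cont by (simp add: continuous_map_paired)
      show "(\<lambda>q. (q, F q, F' q)) ` (\<lambda>s. \<phi> s x) ` ?K = (\<lambda>t. \<rho> t (x, F x, F' x)) ` ?K"
        if "x \<in> topspace M" for x
        using that \<open>F \<in> \<Phi>\<close> \<open>F' \<in> \<Phi>\<close> equiv by (simp add: \<rho>_def image_image)
    qed (use that M.act_in in auto)
    then show ?thesis by (simp add: A_def)
  qed
  have A2: "(p, w, F' p) \<in> A" if F': "F' \<in> \<Phi>" for F'
  proof (rule closure_A)
    show "(p, w, F' p) \<in> topspace ?P" using p wv in_Y F' by simp
    fix W assume W: "openin ?P W" "(p, w, F' p) \<in> W"
    obtain U U1 where U: "openin M U" "p \<in> U" "openin ?YY U1" "(w, F' p) \<in> U1" "U \<times> U1 \<subseteq> W"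
      using W unfolding openin_prod_topology_alt[of M] by meson
    obtain U2 U3 where U23: "openin Y U2" "openin Y U3" "w \<in> U2" "F' p \<in> U3" "U2 \<times> U3 \<subseteq> U1"
      using U(3,4) unfolding openin_prod_topology_alt by meson
    define V where "V = U \<inter> {q \<in> topspace M. F' q \<in> U3}"
    have "V \<in> nhd"
      using U(1,2) U23(2,4) p openin_continuous_map_preimage[OF cont[OF F'] U23(2)]
      by (auto simp: nhd_def V_def)
    then obtain F q where F: "F \<in> \<Phi>" "q \<in> V" "F q \<in> U2"
      using meets[of V U2 "topspace Y"] U23(1,3) wv(2) by auto
    then have "(q, F q, F' q) \<in> W" using U(5) U23(5) by (auto simp: V_def)
    moreover have "(q, F q, F' q) \<in> A" using A1 F F' by (simp add: V_def)
    ultimately show "\<exists>y \<in> A. y \<in> W" by blast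
  qed
  have A3: "(p, w, v) \<in> A"
  proof (rule closure_A)
    show "(p, w, v) \<in> topspace ?P" using p wv by simp
    fix W assume W: "openin ?P W" "(p, w, v) \<in> W"
    obtain U U1 where U: "openin M U" "p \<in> U" "openin ?YY U1" "(w, v) \<in> U1" "U \<times> U1 \<subseteq> W"
      using W unfolding openin_prod_topology_alt[of M] by meson
    obtain U2 U3 where U23: "openin Y U2" "openin Y U3" "w \<in> U2" "v \<in> U3" "U2 \<times> U3 \<subseteq> U1"
      using U(3,4) unfolding openin_prod_topology_alt by meson
    have "topspace M \<in> nhd" using p by (simp add: nhd_def)
    then obtain F where F: "F \<in> \<Phi>" "F p \<in> U3"
      using meets[of "topspace M" "topspace Y" U3] U23(2,4) wv(1) by auto
    then have "(p, w, F p) \<in> W" using U U23 by auto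
    then show "\<exists>y \<in> A. y \<in> W" using A2 F by blast
  qed
  define z where "z = (p, w, v)"
  have z: "z \<in> topspace ?P" using p wv by (simp add: z_def)
  \<comment> \<open>The points that \<open>g\<close> moves into the region where the two values are far apart.\<close>
  define E where "E g = {y \<in> topspace ?P. \<bar>f (fst (snd (\<rho> g y))) - f (snd (snd (\<rho> g y)))\<bar> \<in> {\<epsilon><..}}" for g
  have open_E: "openin ?P (E g)" if "g \<in> ?K" for g
    unfolding E_def
    by (rule openin_continuous_map_preimage)
      (use continuous_map_compose[OF continuous_map_compose[OF P.act_continuous[OF that] continuous_map_snd] D]
        in \<open>auto simp: o_def\<close>)
  have "orbcl ?P \<rho> ?K z \<subseteq> \<Union>(E ` ?K)"
  proof
    fix y assume y: "y \<in> orbcl ?P \<rho> ?K z"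
    then have "z \<in> orbcl ?P \<rho> ?K y" using A3 by (simp add: A_def almost_periodic_def z_def)
    moreover have "z \<in> E \<one>\<^bsub>G\<^esub>"
      using z far less P.act_one[OF z] by (simp add: E_def z_def)
    ultimately obtain g where "g \<in> ?K" "\<rho> g y \<in> E \<one>\<^bsub>G\<^esub>"
      using open_E[OF M.one_closed] unfolding orbcl_def in_closure_of by blast
    moreover have "y \<in> topspace ?P" using y orbcl_in_topspace by fastforce
    ultimately have "y \<in> E g"
      using P.act_one[of "\<rho> g y"] by (simp add: E_def)
    then show "y \<in> \<Union>(E ` ?K)" using \<open>g \<in> ?K\<close> by blast
  qed
  moreover have "compactin ?P (orbcl ?P \<rho> ?K z)"
    using P.compact by (simp add: closedin_compact_space)
  ultimately obtain \<F> where \<F>: "finite \<F>" "\<F> \<subseteq> E ` ?K" "orbcl ?P \<rho> ?K z \<subseteq> \<Union>\<F>"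
    using compactinD[of ?P "orbcl ?P \<rho> ?K z" "E ` ?K"] open_E by blast
  then obtain L where L: "finite L" "L \<subseteq> ?K" "orbcl ?P \<rho> ?K z \<subseteq> \<Union>(E ` L)"
    using finite_subset_image[OF \<F>(1,2)] by auto
  \<comment> \<open>Shrinking once for each element of \<open>L\<close>.\<close>
  have "\<exists>W. openin M W \<and> W \<noteq> {} \<and> (\<forall>g \<in> L. \<exists>U. openin M U \<and> \<phi> g ` W \<subseteq> U \<and>
      (\<forall>F\<in>\<Phi>. \<forall>a\<in>U. \<forall>b\<in>U. \<bar>f (F a) - f (F b)\<bar> \<le> \<epsilon>))"
    using L(1,2)
  proof (induction L rule: finite_induct)
    case empty
    then show ?case using p by blast
  next
    case (insert g L)
    then obtain W where W: "openin M W" "W \<noteq> {}"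
      "\<forall>g \<in> L. \<exists>U. openin M U \<and> \<phi> g ` W \<subseteq> U \<and>
        (\<forall>F\<in>\<Phi>. \<forall>a\<in>U. \<forall>b\<in>U. \<bar>f (F a) - f (F b)\<bar> \<le> \<epsilon>)" by auto
    have g: "g \<in> ?K" using insert.prems by simp
    define V where "V = {y \<in> topspace M. \<phi> (inv\<^bsub>G\<^esub> g) y \<in> W}"
    have V: "openin M V"
      unfolding V_def using openin_continuous_map_preimage M.act_continuous g W(1) by blast
    obtain x where "x \<in> W" using W(2) by blast
    then have "\<phi> g x \<in> V"
      using openin_subset[OF W(1)] g M.act_inverse(1) M.act_in by (auto simp: V_def)
    then obtain U where U: "openin M U" "U \<noteq> {}" "U \<subseteq> V"
      "\<forall>F\<in>\<Phi>. \<forall>a\<in>U. \<forall>b\<in>U. \<bar>f (F a) - f (F b)\<bar> \<le> \<epsilon>" using small[OF V] by blast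
    obtain y where y: "y \<in> U" using U(2) by blast
    define W' where "W' = W \<inter> {x \<in> topspace M. \<phi> g x \<in> U}"
    have "\<phi> (inv\<^bsub>G\<^esub> g) y \<in> W'"
      using y U(3) g M.act_inverse(2) M.act_in by (auto simp: W'_def V_def)
    moreover have "openin M W'"
      unfolding W'_def using W(1) openin_continuous_map_preimage[OF M.act_continuous[OF g] U(1)] by blast
    moreover have "\<phi> h ` W' \<subseteq> \<phi> h ` W" for h by (auto simp: W'_def)
    moreover have "\<phi> g ` W' \<subseteq> U" by (auto simp: W'_def)
    ultimately show ?case
      using W(3) U(1,4) by (intro exI[of _ W']) (auto, meson subset_trans)
  qed
  then obtain W where W: "openin M W" "W \<noteq> {}" and small_W:
    "\<And>g. g \<in> L \<Longrightarrow> \<exists>U. openin M U \<and> \<phi> g ` W \<subseteq> U \<and>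
      (\<forall>F\<in>\<Phi>. \<forall>a\<in>U. \<forall>b\<in>U. \<bar>f (F a) - f (F b)\<bar> \<le> \<epsilon>)" by blast
  obtain x where x: "x \<in> W" using W(2) by blast
  then have "x \<in> orbcl M \<phi> ?K p" using minimal[OF p] openin_subset[OF W(1)] by blast
  then obtain h where h: "h \<in> ?K" "\<phi> h p \<in> W"
    using x W(1) unfolding orbcl_def in_closure_of by blast
  have hz: "\<rho> h z \<in> orbcl ?P \<rho> ?K z" by (rule P.orbit_subset_orbcl[OF z h(1)])
  then obtain g where g: "g \<in> L" "\<rho> h z \<in> E g" using L(3) by blast
  then have gK: "g \<in> ?K" using L(2) by blast
  obtain U where U: "openin M U" "\<phi> g ` W \<subseteq> U"
    "\<forall>F\<in>\<Phi>. \<forall>a\<in>U. \<forall>b\<in>U. \<bar>f (F a) - f (F b)\<bar> \<le> \<epsilon>" using small_W[OF g(1)] by blast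
  have "\<phi> (g \<otimes>\<^bsub>G\<^esub> h) p \<in> U" using U(2) h M.act_mult[OF gK h(1) p] by auto
  then have "\<bar>f (\<psi> (g \<otimes>\<^bsub>G\<^esub> h) w) - f (\<psi> (g \<otimes>\<^bsub>G\<^esub> h) v)\<bar> \<le> \<epsilon>"
    using near[OF M.m_closed[OF gK h(1)] U(1) _ U(3)] by blast
  moreover have "\<bar>f (\<psi> (g \<otimes>\<^bsub>G\<^esub> h) w) - f (\<psi> (g \<otimes>\<^bsub>G\<^esub> h) v)\<bar> > \<epsilon>"
    using g(2) Y.act_mult[OF gK h(1)] wv by (simp add: E_def \<rho>_def z_def)
  ultimately show False by simp
qed

text \<open>The modulus of continuity is given by neighbourhoods \<open>U \<eta>\<close> of the unit that multiply from the
left. Right translations then preserve the set, and with the topology of pointwise convergence it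
is a flow through which real functions on a flow can be turned into equivariant maps.\<close>

definition equicontinuous_functions ::
  "('g, 'm) monoid_scheme \<Rightarrow> (real \<Rightarrow> 'g set) \<Rightarrow> real \<Rightarrow> ('g \<Rightarrow> real) set" where
  "equicontinuous_functions G U c =
     {v \<in> carrier G \<rightarrow>\<^sub>E {0..c}.
        \<forall>\<eta>>0. \<forall>u \<in> U \<eta>. \<forall>a \<in> carrier G. \<bar>v (u \<otimes>\<^bsub>G\<^esub> a) - v a\<bar> \<le> \<eta>}"

text \<open>Pointwise convergence alone does not make translation jointly continuous; the common modulus does:
\<open>w (a h)\<close> differs little from \<open>w (a g)\<close>, uniformly in \<open>w\<close>, since \<open>(a h) (a g)\<inverse>\<close> is close to the
unit.\<close>

lemma compact_action_translation:
  fixes G :: "('g, 'm) monoid_scheme" and U :: "real \<Rightarrow> 'g set"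
  assumes tg: "topological_group G T"
    and U: "\<And>\<eta>. \<eta> > 0 \<Longrightarrow> openin T (U \<eta>) \<and> \<one>\<^bsub>G\<^esub> \<in> U \<eta>"
  shows "compact_action G T
    (subtopology (product_topology (\<lambda>_. euclideanreal) (carrier G)) (equicontinuous_functions G U c))
    (\<lambda>g v. \<lambda>a\<in>carrier G. v (a \<otimes>\<^bsub>G\<^esub> g))"
proof -
  let ?K = "carrier G"
  define P where "P = product_topology (\<lambda>_ :: 'g. euclideanreal) ?K"
  define L where "L = equicontinuous_functions G U c"
  have gr: "group G" and topT: "topspace T = ?K"
    and mult: "continuous_map (prod_topology T T) T (\<lambda>(g, h). g \<otimes>\<^bsub>G\<^esub> h)"
    using tg by (auto simp: topological_group_def)
  interpret group G by (rule gr)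
  have UK: "U \<eta> \<subseteq> ?K" if "\<eta> > 0" for \<eta> using U[OF that] openin_subset topT by metis
  have Lsub: "L \<subseteq> ?K \<rightarrow>\<^sub>E {0..c}" by (auto simp: L_def equicontinuous_functions_def)
  have topP: "topspace P = ?K \<rightarrow>\<^sub>E UNIV" by (simp add: P_def)
  have LP: "L \<subseteq> topspace P" using Lsub by (auto simp: topP PiE_def)
  have coord: "continuous_map P euclideanreal (\<lambda>v. v a)" if "a \<in> ?K" for a
    unfolding P_def by (rule continuous_map_product_projection[OF that])
  have cpt: "compactin P (?K \<rightarrow>\<^sub>E {0..c})"
    by (simp add: P_def compactin_PiE)
  have "closedin P L"
  proof -
    have closed1: "closedin P (?K \<rightarrow>\<^sub>E {0..c})"
      by (simp add: P_def closedin_product_topology)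
    have closed2: "closedin P {v \<in> topspace P. \<bar>v (u \<otimes>\<^bsub>G\<^esub> a) - v a\<bar> \<in> {..\<eta>}}"
      if "u \<in> ?K" "a \<in> ?K" for u a \<eta>
      by (rule closedin_continuous_map_preimage[of P euclideanreal])
        (use that in \<open>auto intro!: continuous_map_real_abs continuous_map_diff coord\<close>)
    define \<C> where "\<C> = insert (?K \<rightarrow>\<^sub>E {0..c})
      ((\<lambda>(u, a, \<eta>). {v \<in> topspace P. \<bar>v (u \<otimes>\<^bsub>G\<^esub> a) - v a\<bar> \<in> {..\<eta>}})
        ` {(u, a, \<eta>). \<eta> > 0 \<and> u \<in> U \<eta> \<and> a \<in> ?K})"
    have "L = \<Inter>\<C>"
      using LP by (auto simp: L_def equicontinuous_functions_def \<C>_def)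
    moreover have "closedin P (\<Inter>\<C>)"
      by (rule closedin_Inter) (use closed1 closed2 subsetD[OF UK] in \<open>auto simp: \<C>_def\<close>)
    ultimately show ?thesis by simp
  qed
  then have "compactin P L" using closed_compactin[OF cpt Lsub] by simp
  then have comp: "compact_space (subtopology P L)" using compact_space_subtopology by blast
  have haus: "Hausdorff_space (subtopology P L)"
    by (simp add: P_def Hausdorff_space_subtopology Hausdorff_space_product_topology)
  have trans_L: "(\<lambda>a\<in>?K. v (a \<otimes>\<^bsub>G\<^esub> g)) \<in> L" if g: "g \<in> ?K" and v: "v \<in> L" for g v
  proof -
    have "\<bar>v (u \<otimes>\<^bsub>G\<^esub> a \<otimes>\<^bsub>G\<^esub> g) - v (a \<otimes>\<^bsub>G\<^esub> g)\<bar> \<le> \<eta>"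
      if "\<eta> > 0" "u \<in> U \<eta>" "a \<in> ?K" for \<eta> u a
    proof -
      have "u \<in> ?K" using UK that by blast
      then show ?thesis
        using v that g m_assoc by (auto simp: L_def equicontinuous_functions_def)
    qed
    moreover have "v a \<in> {0..c}" if "a \<in> ?K" for a using v Lsub that by blast
    ultimately show ?thesis
      using g UK by (force simp: L_def equicontinuous_functions_def)
  qed
  have mult_cont: "continuous_map T T (\<lambda>g. a \<otimes>\<^bsub>G\<^esub> g \<otimes>\<^bsub>G\<^esub> b)" if "a \<in> ?K" "b \<in> ?K" for a b
  proof -
    have "continuous_map T (prod_topology T T) (\<lambda>g. (a, g))"
      using that topT by (simp add: continuous_map_paired)
    from continuous_map_compose[OF this mult] have l: "continuous_map T T (\<lambda>g. a \<otimes>\<^bsub>G\<^esub> g)"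
      by (simp add: o_def)
    have "continuous_map T (prod_topology T T) (\<lambda>g. (a \<otimes>\<^bsub>G\<^esub> g, b))"
      using that topT l by (simp add: continuous_map_paired)
    from continuous_map_compose[OF this mult] show ?thesis by (simp add: o_def)
  qed
  have eval: "continuous_map (prod_topology T (subtopology P L)) euclideanreal (\<lambda>p. snd p (a \<otimes>\<^bsub>G\<^esub> fst p))"
    if a: "a \<in> ?K" for a
    unfolding continuous_map_eq_topcontinuous_at topcontinuous_at_def
  proof (intro ballI conjI allI impI)
    fix p V assume p: "p \<in> topspace (prod_topology T (subtopology P L))"
      and V: "openin euclideanreal V \<and> snd p (a \<otimes>\<^bsub>G\<^esub> fst p) \<in> V"
    obtain g v where gv: "p = (g, v)" "g \<in> ?K" "v \<in> L" using p topT LP by auto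
    obtain e where e: "e > 0" "\<And>r. \<bar>r - v (a \<otimes>\<^bsub>G\<^esub> g)\<bar> < e \<Longrightarrow> r \<in> V"
      using V gv(1) by (auto simp: open_real)
    let ?b = "inv\<^bsub>G\<^esub> g \<otimes>\<^bsub>G\<^esub> inv\<^bsub>G\<^esub> a"
    define N where "N = {h \<in> topspace T. a \<otimes>\<^bsub>G\<^esub> h \<otimes>\<^bsub>G\<^esub> ?b \<in> U (e/2)}"
    define Q where "Q = {w \<in> topspace (subtopology P L). w (a \<otimes>\<^bsub>G\<^esub> g) \<in> {v (a \<otimes>\<^bsub>G\<^esub> g) - e/2 <..< v (a \<otimes>\<^bsub>G\<^esub> g) + e/2}}"
    have b: "?b \<in> ?K" using a gv by simp
    have N: "openin T N"
      unfolding N_def using openin_continuous_map_preimage mult_cont[OF a b] U e(1) half_gt_zero by blast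
    have Q: "openin (subtopology P L) Q"
      unfolding Q_def
      by (rule openin_continuous_map_preimage[of _ euclideanreal])
        (use a gv coord in \<open>auto intro!: continuous_map_from_subtopology\<close>)
    have "a \<otimes>\<^bsub>G\<^esub> g \<otimes>\<^bsub>G\<^esub> ?b = \<one>\<^bsub>G\<^esub>"
      using a gv by (metis inv_mult_group m_closed r_inv)
    then have pN: "p \<in> N \<times> Q"
      using gv e(1) topT U[of "e/2"] LP by (auto simp: N_def Q_def)
    have "snd r (a \<otimes>\<^bsub>G\<^esub> fst r) \<in> V" if rNQ: "r \<in> N \<times> Q" for r
    proof (rule e(2))
      obtain h w where r: "r = (h, w)" "h \<in> ?K" "w \<in> L" using rNQ topT by (cases r) (auto simp: N_def Q_def)
      have "(a \<otimes>\<^bsub>G\<^esub> h \<otimes>\<^bsub>G\<^esub> ?b) \<otimes>\<^bsub>G\<^esub> (a \<otimes>\<^bsub>G\<^esub> g) = a \<otimes>\<^bsub>G\<^esub> h"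
        using a gv r by (metis b inv_mult_group inv_closed inv_solve_right m_closed)
      moreover have "a \<otimes>\<^bsub>G\<^esub> h \<otimes>\<^bsub>G\<^esub> ?b \<in> U (e/2)" using rNQ r(1) by (simp add: N_def)
      ultimately have "\<bar>w (a \<otimes>\<^bsub>G\<^esub> h) - w (a \<otimes>\<^bsub>G\<^esub> g)\<bar> \<le> e/2"
        using r(3) e(1) a gv(2) unfolding L_def equicontinuous_functions_def
        by (metis (mono_tags, lifting) half_gt_zero m_closed mem_Collect_eq)
      moreover have "\<bar>w (a \<otimes>\<^bsub>G\<^esub> g) - v (a \<otimes>\<^bsub>G\<^esub> g)\<bar> < e/2"
      proof -
        have "v (a \<otimes>\<^bsub>G\<^esub> g) - e/2 < w (a \<otimes>\<^bsub>G\<^esub> g)" "w (a \<otimes>\<^bsub>G\<^esub> g) < v (a \<otimes>\<^bsub>G\<^esub> g) + e/2"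
          using rNQ r(1) by (simp_all add: Q_def)
        then show ?thesis by linarith
      qed
      ultimately have "\<bar>w (a \<otimes>\<^bsub>G\<^esub> h) - v (a \<otimes>\<^bsub>G\<^esub> g)\<bar> < e" by linarith
      then show "\<bar>snd r (a \<otimes>\<^bsub>G\<^esub> fst r) - v (a \<otimes>\<^bsub>G\<^esub> g)\<bar> < e" using r(1) by simp
    qed
    moreover have "openin (prod_topology T (subtopology P L)) (N \<times> Q)"
      using N Q by (simp add: openin_prod_Times_iff)
    ultimately show "\<exists>W. openin (prod_topology T (subtopology P L)) W \<and> p \<in> W \<and>
        (\<forall>r\<in>W. snd r (a \<otimes>\<^bsub>G\<^esub> fst r) \<in> V)" using pN by blast
  qed auto
  have "continuous_map (prod_topology T (subtopology P L)) P (\<lambda>p. \<lambda>a\<in>?K. snd p (a \<otimes>\<^bsub>G\<^esub> fst p))"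
    unfolding P_def continuous_map_componentwise
    by (intro conjI ballI) (use eval[unfolded P_def] in auto)
  moreover have "(\<lambda>p. \<lambda>a\<in>?K. snd p (a \<otimes>\<^bsub>G\<^esub> fst p)) \<in> topspace (prod_topology T (subtopology P L)) \<rightarrow> L"
    using trans_L topT by auto
  ultimately have cont: "continuous_map (prod_topology T (subtopology P L)) (subtopology P L)
      (\<lambda>p. \<lambda>a\<in>?K. snd p (a \<otimes>\<^bsub>G\<^esub> fst p))"
    by (simp add: continuous_map_in_subtopology)
  have "compact_action G T (subtopology P L) (\<lambda>g v. \<lambda>a\<in>?K. v (a \<otimes>\<^bsub>G\<^esub> g))"
  proof
    show "(\<lambda>a\<in>?K. v (a \<otimes>\<^bsub>G\<^esub> \<one>\<^bsub>G\<^esub>)) = v" if "v \<in> topspace (subtopology P L)" for v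
      using that Lsub by (intro extensionalityI[of _ ?K]) (auto simp: PiE_def)
    show "(\<lambda>a\<in>?K. v (a \<otimes>\<^bsub>G\<^esub> (g \<otimes>\<^bsub>G\<^esub> h))) = (\<lambda>a\<in>?K. (\<lambda>a\<in>?K. v (a \<otimes>\<^bsub>G\<^esub> h)) (a \<otimes>\<^bsub>G\<^esub> g))"
      if "g \<in> ?K" "h \<in> ?K" for g h v
      using that by (auto simp: m_assoc)
  qed (use tg comp haus cont in \<open>simp_all add: case_prod_unfold\<close>)
  then show ?thesis by (simp add: P_def L_def)
qed

lemma (in compact_action) uniform_on_compact:
  fixes f :: "'x \<Rightarrow> real"
  assumes f: "continuous_map X euclideanreal f" and e: "\<eta> > 0"
  shows "\<exists>U. openin T U \<and> \<one>\<^bsub>G\<^esub> \<in> U \<and> (\<forall>u\<in>U. \<forall>x\<in>topspace X. \<bar>f (\<phi> u x) - f x\<bar> < \<eta>)"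
proof -
  let ?W = "{p \<in> topspace (prod_topology T X). \<bar>f (\<phi> (fst p) (snd p)) - f (snd p)\<bar> \<in> {..<\<eta>}}"
  have "continuous_map (prod_topology T X) euclideanreal (\<lambda>p. f (\<phi> (fst p) (snd p)))"
    using continuous_map_compose[OF jointly_continuous f] by (simp add: o_def case_prod_unfold)
  moreover have "continuous_map (prod_topology T X) euclideanreal (\<lambda>p. f (snd p))"
    using continuous_map_compose[OF continuous_map_snd f] by (simp add: o_def)
  ultimately have "continuous_map (prod_topology T X) euclideanreal (\<lambda>p. \<bar>f (\<phi> (fst p) (snd p)) - f (snd p)\<bar>)"
    by (intro continuous_map_real_abs continuous_map_diff)
  then have "openin (prod_topology T X) ?W"
    by (rule openin_continuous_map_preimage) simp
  moreover have "compactin X (topspace X)" using compact by (simp add: compact_space_def)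
  moreover have "\<one>\<^bsub>G\<^esub> \<in> topspace T" by (simp add: topspace_group)
  moreover have "{\<one>\<^bsub>G\<^esub>} \<times> topspace X \<subseteq> ?W" using e by (auto simp: topspace_group act_one)
  ultimately obtain U V where "openin T U" "\<one>\<^bsub>G\<^esub> \<in> U" "topspace X \<subseteq> V" "U \<times> V \<subseteq> ?W"
    using tube_lemma_right[of T X ?W "topspace X" "\<one>\<^bsub>G\<^esub>"] by blast
  then show ?thesis by (intro exI[of _ U]) (auto simp: subset_iff)
qed

text \<open>Otherwise there are maps \<open>F k\<close>, points \<open>q k\<close> and decreasing open sets \<open>W k\<close> such that \<open>q l\<close>, for every
\<open>l > k\<close>, lies where \<open>f \<circ> F k\<close> is farther than \<open>\<epsilon>\<close> from its value at \<open>q k\<close>. The functions \<open>g k\<close> are bumps at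
\<open>q k\<close> that vanish at all later points; subtracting the earlier bumps and \<open>\<epsilon>/2\<close> makes the supports
of the functions \<open>h k\<close> disjoint and keeps the value \<open>\<epsilon>/2\<close> at \<open>q k\<close>. The maxima \<open>H n\<close> of the first
\<open>n\<close> of them inherit a modulus of continuity from \<open>f\<close>, so they correspond to equivariant maps into a
translation flow. They have small oscillation near any point where some \<open>h k\<close> is positive, since
\<open>H n\<close> is either \<open>0\<close> or \<open>h k\<close> there. Hence they are equicontinuous at a cluster point \<open>p\<close> of the
points \<open>q k\<close>. But \<open>H (Suc k)\<close> equals \<open>\<epsilon>/2\<close> at \<open>q k\<close>, while \<open>H l\<close> vanishes at \<open>q l\<close>; so the values of the
increasing sequence \<open>H n p\<close> would drop below \<open>\<epsilon>/4\<close> after having exceeded it.\<close>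

lemma ex_small_oscillation:
  fixes G :: "('g, 'm) monoid_scheme" and f :: "'y \<Rightarrow> real"
  assumes cap: "CAP TYPE('g \<Rightarrow> real) G T"
    and M: "compact_action G T M \<phi>" and Y: "compact_action G T Y \<psi>"
    and minimal: "\<And>x. x \<in> topspace M \<Longrightarrow> orbcl M \<phi> (carrier G) x = topspace M"
    and cont: "\<And>F. F \<in> \<Phi> \<Longrightarrow> continuous_map M Y F"
    and equiv: "\<And>F g x. F \<in> \<Phi> \<Longrightarrow> g \<in> carrier G \<Longrightarrow> x \<in> topspace M \<Longrightarrow> F (\<phi> g x) = \<psi> g (F x)"
    and f: "continuous_map Y euclideanreal f"
    and \<epsilon>: "\<epsilon> > 0" and V: "openin M V" "V \<noteq> {}"
  shows "\<exists>W. openin M W \<and> W \<noteq> {} \<and> W \<subseteq> V \<and> (\<forall>F\<in>\<Phi>. \<forall>a\<in>W. \<forall>b\<in>W. \<bar>f (F a) - f (F b)\<bar> \<le> \<epsilon>)"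
proof (rule ccontr)
  assume neg: "\<not> ?thesis"
  interpret M: compact_action G T M \<phi> by (rule M)
  interpret Y: compact_action G T Y \<psi> by (rule Y)
  let ?K = "carrier G"
  have in_Y: "F x \<in> topspace Y" if "F \<in> \<Phi>" "x \<in> topspace M" for F x
    using cont[OF that(1)] that(2) continuous_map_image_subset_topspace by fastforce
  have "\<exists>F a. openin M W \<and> W \<noteq> {} \<and> W \<subseteq> V \<longrightarrow>
      F \<in> \<Phi> \<and> a \<in> W \<and> (\<exists>b\<in>W. \<epsilon> < \<bar>f (F b) - f (F a)\<bar>)" for W
    using neg by (meson not_le)
  then obtain Fc ac where choice: "\<And>W. openin M W \<Longrightarrow> W \<noteq> {} \<Longrightarrow> W \<subseteq> V \<Longrightarrow>
      Fc W \<in> \<Phi> \<and> ac W \<in> W \<and> (\<exists>b\<in>W. \<epsilon> < \<bar>f (Fc W b) - f (Fc W (ac W))\<bar>)"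
    by metis
  define W where "W n = ((\<lambda>W. {x \<in> W. \<bar>f (Fc W x) - f (Fc W (ac W))\<bar> \<in> {\<epsilon><..}}) ^^ n) V" for n
  define F where "F n = Fc (W n)" for n
  define q where "q n = ac (W n)" for n
  have W0: "W 0 = V" by (simp add: W_def)
  have WS: "W (Suc n) = {x \<in> W n. \<bar>f (F n x) - f (F n (q n))\<bar> \<in> {\<epsilon><..}}" for n
    by (simp add: W_def F_def q_def)
  have cont_f: "continuous_map M euclideanreal (\<lambda>x. f (F' x))" if "F' \<in> \<Phi>" for F'
    using continuous_map_compose[OF cont[OF that] f] by (simp add: o_def)
  have W: "openin M (W n) \<and> W n \<noteq> {} \<and> W n \<subseteq> V" for n
  proof (induction n)
    case 0
    then show ?case using V by (simp add: W0)
  next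
    case (Suc n)
    then have F: "F n \<in> \<Phi>" "\<exists>b\<in>W n. \<epsilon> < \<bar>f (F n b) - f (F n (q n))\<bar>"
      using choice[of "W n"] by (auto simp: F_def q_def)
    have "openin M (W (Suc n))"
      unfolding WS
      by (rule openin_continuous_map_preimage_gen[of M euclideanreal])
        (use Suc cont_f[OF F(1)] in \<open>auto intro!: continuous_map_real_abs continuous_map_diff\<close>)
    then show ?case using F(2) Suc by (auto simp: WS)
  qed
  have F: "F n \<in> \<Phi>" and q: "q n \<in> W n" for n
    using choice[of "W n"] W[of n] by (auto simp: F_def q_def)
  have qM: "q n \<in> topspace M" for n using q[of n] W[of n] openin_subset by blast
  have antimono: "W n \<subseteq> W k" if "k \<le> n" for k n
    using that by (rule lift_Suc_antimono_le[rotated]) (auto simp: WS)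
  have separated: "\<bar>f (F k (q l)) - f (F k (q k))\<bar> > \<epsilon>" if "k < l" for k l
    using antimono[of "Suc k" l] q[of l] that by (auto simp: WS)
  define g where "g k x = max 0 (\<epsilon> - \<bar>f (F k x) - f (F k (q k))\<bar>)" for k x
  define m where "m k x = rec_nat 0 (\<lambda>j r. max r (g j x)) k" for k x
  define h where "h k x = max 0 (g k x - \<epsilon>/2 - m k x)" for k x
  define H where "H k x = rec_nat 0 (\<lambda>j r. max r (h j x)) k" for k x
  have m_rec: "m 0 x = 0" "m (Suc k) x = max (m k x) (g k x)" for k x by (simp_all add: m_def)
  have H_rec: "H 0 x = 0" "H (Suc k) x = max (H k x) (h k x)" for k x by (simp_all add: H_def)
  have m_nonneg: "0 \<le> m k x" for k x by (induction k) (auto simp: m_rec)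
  have m_ge: "j < k \<Longrightarrow> g j x \<le> m k x" for j k x
    by (induction k) (auto simp: m_rec less_Suc_eq)
  have g_le: "g k x \<le> \<epsilon>" for k x using \<epsilon> by (simp add: g_def)
  have h_nonneg: "0 \<le> h k x" and h_le: "h k x \<le> \<epsilon>" for k x
    using m_nonneg[of k x] g_le[of k x] \<epsilon> by (auto simp: h_def)
  have H_bounds: "0 \<le> H k x \<and> H k x \<le> \<epsilon>" for k x
    using h_nonneg h_le \<epsilon> by (induction k) (auto simp: H_rec)
  have H_mono: "H k x \<le> H l x" if "k \<le> l" for k l x
    using that by (rule lift_Suc_mono_le[rotated]) (simp add: H_rec)
  have "k \<le> l \<Longrightarrow> m k (q l) = 0" for k l
    using separated by (induction k) (force simp: m_rec g_def)+
  then have h_q: "h k (q k) = \<epsilon>/2" for k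
    using \<epsilon> by (simp add: h_def g_def)
  \<comment> \<open>If \<open>h k x > 0\<close>, then \<open>g j x < g k x - \<epsilon>/2 \<le> \<epsilon>/2\<close> for every earlier \<open>j\<close>.\<close>
  have disjoint_less: "h j x = 0" if "0 < h k x" "j < k" for j k x
    using that m_ge[of j k x] g_le[of k x] m_nonneg[of j x] by (auto simp: h_def)
  have disjoint: "h j x = 0" if "0 < h k x" "j \<noteq> k" for j k x
    using that disjoint_less[of j x k] disjoint_less[of k x j] h_nonneg[of j x]
    by (metis less_irrefl linorder_neqE_nat order_le_less)
  have H_on: "H n x = (if k < n then h k x else 0)" if "0 < h k x" for k n x
    using disjoint[OF that] that by (induction n) (auto simp: H_rec less_Suc_eq)
  have H_off: "H n x = 0" if "\<And>k. h k x = 0" for n x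
    using that by (induction n) (auto simp: H_rec)
  have cont_g: "continuous_map M euclideanreal (g k)" for k
    unfolding g_def
    by (intro continuous_map_real_max continuous_map_diff continuous_map_real_abs cont_f[OF F]) auto
  have cont_m: "continuous_map M euclideanreal (m k)" for k
    by (induction k) (auto simp: m_rec intro!: continuous_map_real_max cont_g)
  have cont_h: "continuous_map M euclideanreal (h k)" for k
    unfolding h_def by (intro continuous_map_real_max continuous_map_diff cont_g cont_m) auto
  have cont_H: "continuous_map M euclideanreal (H k)" for k
    by (induction k) (auto simp: H_rec intro!: continuous_map_real_max cont_h)
  have "\<exists>U. \<eta> > 0 \<longrightarrow> openin T U \<and> \<one>\<^bsub>G\<^esub> \<in> U \<and>
      (\<forall>u\<in>U. \<forall>y\<in>topspace Y. \<bar>f (\<psi> u y) - f y\<bar> < \<eta>/2)" for \<eta> :: real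
    using Y.uniform_on_compact[OF f, of "\<eta>/2"] by auto
  then obtain U where U: "\<And>\<eta>. \<eta> > 0 \<Longrightarrow> openin T (U \<eta>) \<and> \<one>\<^bsub>G\<^esub> \<in> U \<eta>"
    and U_f: "\<And>\<eta> u y. \<eta> > 0 \<Longrightarrow> u \<in> U \<eta> \<Longrightarrow> y \<in> topspace Y \<Longrightarrow> \<bar>f (\<psi> u y) - f y\<bar> < \<eta>/2"
    by metis
  have UK: "U \<eta> \<subseteq> ?K" if "\<eta> > 0" for \<eta>
    using U[OF that] openin_subset M.topspace_group by metis
  \<comment> \<open>The modulus is halved for \<open>f\<close> because \<open>h k\<close> is a difference of two functions built from \<open>f\<close>.\<close>
  have U_H: "\<bar>H n (\<phi> u x) - H n x\<bar> \<le> \<eta>" if "\<eta> > 0" "u \<in> U \<eta>" "x \<in> topspace M" for n \<eta> u x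
  proof -
    have "u \<in> ?K" using UK that by blast
    then have F_u: "\<bar>f (F k (\<phi> u x)) - f (F k x)\<bar> < \<eta>/2" for k
      using U_f[OF that(1,2), of "F k x"] in_Y F that(3) equiv by simp
    have g_u: "\<bar>g k (\<phi> u x) - g k x\<bar> \<le> \<eta>/2" for k
      using F_u[of k] unfolding g_def by linarith
    have m_u: "\<bar>m k (\<phi> u x) - m k x\<bar> \<le> \<eta>/2" for k
    proof (induction k)
      case (Suc k)
      then show ?case using g_u[of k] unfolding m_rec by linarith
    qed (use that in \<open>simp add: m_rec\<close>)
    have h_u: "\<bar>h k (\<phi> u x) - h k x\<bar> \<le> \<eta>" for k
      using g_u[of k] m_u[of k] unfolding h_def by linarith
    show ?thesis
    proof (induction n)
      case (Suc n)
      then show ?case using h_u[of n] unfolding H_rec by linarith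
    qed (use that in \<open>simp add: H_rec\<close>)
  qed
  define L where "L = subtopology (product_topology (\<lambda>_. euclideanreal) ?K)
    (equicontinuous_functions G U \<epsilon>)"
  define \<tau> where "\<tau> = (\<lambda>g v. \<lambda>a\<in>?K. v (a \<otimes>\<^bsub>G\<^esub> g) :: real)"
  have L: "compact_action G T L \<tau>"
    unfolding L_def \<tau>_def by (rule compact_action_translation[OF M.topological_group U])
  define \<Theta> where "\<Theta> = range (\<lambda>n x. \<lambda>a\<in>?K. H n (\<phi> a x))"
  have H_L: "(\<lambda>a\<in>?K. H n (\<phi> a x)) \<in> equicontinuous_functions G U \<epsilon>" if x: "x \<in> topspace M" for n x
  proof -
    have "\<bar>H n (\<phi> (u \<otimes>\<^bsub>G\<^esub> a) x) - H n (\<phi> a x)\<bar> \<le> \<eta>" "u \<otimes>\<^bsub>G\<^esub> a \<in> ?K"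
      if "\<eta> > 0" "u \<in> U \<eta>" "a \<in> ?K" for \<eta> u a
    proof -
      have u: "u \<in> ?K" using UK that by blast
      then show "u \<otimes>\<^bsub>G\<^esub> a \<in> ?K" using that by simp
      show "\<bar>H n (\<phi> (u \<otimes>\<^bsub>G\<^esub> a) x) - H n (\<phi> a x)\<bar> \<le> \<eta>"
        using U_H[OF that(1,2), of "\<phi> a x"] M.act_in that(3) x u M.act_mult by simp
    qed
    then show ?thesis using H_bounds by (auto simp: equicontinuous_functions_def)
  qed
  have topL: "topspace L = equicontinuous_functions G U \<epsilon>"
    by (auto simp: L_def equicontinuous_functions_def)
  have eval_\<Theta>: "(\<lambda>a\<in>?K. H n (\<phi> a x)) \<one>\<^bsub>G\<^esub> = H n x" if "x \<in> topspace M" for n x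
    using that M.act_one by simp
  have ex_p: "\<exists>p \<in> topspace M. \<forall>n \<in> UNIV. p \<in> M closure_of (q ` {n..})"
  proof (rule directed_family_cluster_point[OF M.compact])
    show "\<exists>k\<in>UNIV. q ` {k..} \<subseteq> q ` {i..} \<inter> q ` {j..}" for i j :: nat
      by (intro bexI[of _ "max i j"]) auto
  qed (use qM in auto)
  then obtain p where p: "p \<in> topspace M" "\<And>n. p \<in> M closure_of (q ` {n..})" by blast
  have "\<exists>V. openin M V \<and> p \<in> V \<and> (\<forall>F\<in>\<Theta>. \<forall>x\<in>V. \<bar>F x \<one>\<^bsub>G\<^esub> - F p \<one>\<^bsub>G\<^esub>\<bar> < \<epsilon>/4)"
  proof (rule small_oscillation_imp_equicontinuous[OF cap M L minimal, where \<epsilon> = "\<epsilon>/8"])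
    fix F' assume "F' \<in> \<Theta>"
    then obtain n where F': "F' = (\<lambda>x. \<lambda>a\<in>?K. H n (\<phi> a x))" by (auto simp: \<Theta>_def)
    have "continuous_map M euclideanreal (\<lambda>x. H n (\<phi> a x))" if "a \<in> ?K" for a
      using continuous_map_compose[OF M.act_continuous[OF that] cont_H] by (simp add: o_def)
    then show "continuous_map M L F'"
      unfolding L_def F' continuous_map_in_subtopology continuous_map_componentwise
      using H_L by auto
    show "F' (\<phi> g x) = \<tau> g (F' x)" if "g \<in> ?K" "x \<in> topspace M" for g x
      using that by (auto simp: F' \<tau>_def M.act_mult)
  next
    show "continuous_map L euclideanreal (\<lambda>v. v \<one>\<^bsub>G\<^esub>)"
      unfolding L_def
      by (rule continuous_map_from_subtopology) (rule continuous_map_product_projection, simp)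
  next
    fix V assume V: "openin M V" "V \<noteq> {}"
    have V_sub: "V \<subseteq> topspace M" using V(1) openin_subset by blast
    show "\<exists>W. openin M W \<and> W \<noteq> {} \<and> W \<subseteq> V \<and>
      (\<forall>F\<in>\<Theta>. \<forall>a\<in>W. \<forall>b\<in>W. \<bar>F a \<one>\<^bsub>G\<^esub> - F b \<one>\<^bsub>G\<^esub>\<bar> \<le> \<epsilon>/8)"
    proof (cases "\<exists>k. \<exists>x\<in>V. 0 < h k x")
      case True
      then obtain k y where y: "y \<in> V" "0 < h k y" by blast
      define W' where "W' = {x \<in> V. h k x \<in> {max 0 (h k y - \<epsilon>/16)<..<h k y + \<epsilon>/16}}"
      have "openin M W'"
        unfolding W'_def by (rule openin_continuous_map_preimage_gen[OF cont_h V(1)]) simp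
      moreover have "y \<in> W'" using y \<epsilon> by (simp add: W'_def)
      moreover have "\<bar>H n a - H n b\<bar> \<le> \<epsilon>/8" if "a \<in> W'" "b \<in> W'" for n a b
      proof -
        have pos: "0 < h k a" "0 < h k b"
          and "h k y - \<epsilon>/16 < h k a" "h k a < h k y + \<epsilon>/16"
            "h k y - \<epsilon>/16 < h k b" "h k b < h k y + \<epsilon>/16"
          using that by (simp_all add: W'_def)
        then have "\<bar>h k a - h k b\<bar> \<le> \<epsilon>/8" by linarith
        then show ?thesis using H_on[OF pos(1), of n] H_on[OF pos(2), of n] \<epsilon> by simp
      qed
      moreover have "W' \<subseteq> V" by (auto simp: W'_def)
      ultimately show ?thesis
        using V_sub by (intro exI[of _ W']) (auto simp: \<Theta>_def eval_\<Theta> subset_iff M.act_one)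
    next
      case False
      then have "\<not> 0 < h k x" if "x \<in> V" for k x
        using that by blast
      then have "h k x = 0" if "x \<in> V" for k x
        using that h_nonneg[of k x] by (simp add: order.antisym not_less)
      then have "H n x = 0" if "x \<in> V" for n x using H_off that by blast
      then show ?thesis
        using V V_sub \<epsilon> by (intro exI[of _ V]) (auto simp: \<Theta>_def subset_iff M.act_one)
    qed
  qed (use \<epsilon> p in auto)
  then obtain N where N: "openin M N" "p \<in> N"
    and N_\<Theta>: "\<And>F x. F \<in> \<Theta> \<Longrightarrow> x \<in> N \<Longrightarrow> \<bar>F x \<one>\<^bsub>G\<^esub> - F p \<one>\<^bsub>G\<^esub>\<bar> < \<epsilon>/4" by blast
  have N_H: "\<bar>H n x - H n p\<bar> < \<epsilon>/4" if x: "x \<in> N" for n x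
  proof -
    have "x \<in> topspace M" using x openin_subset[OF N(1)] by blast
    then show ?thesis
      using N_\<Theta>[of "\<lambda>x. \<lambda>a\<in>?K. H n (\<phi> a x)" x] x p(1) eval_\<Theta> by (auto simp: \<Theta>_def M.act_one)
  qed
  have hit: "\<exists>k\<ge>n. q k \<in> N" for n
    using p(2)[of n] N(1,2) unfolding in_closure_of by blast
  obtain k where k: "q k \<in> N" using hit by blast
  obtain l where l: "l \<ge> Suc k" "q l \<in> N" using hit by blast
  have "H (Suc k) (q k) = \<epsilon>/2" using H_on[of k "q k" "Suc k"] h_q \<epsilon> by simp
  then have "H (Suc k) p > \<epsilon>/4" using N_H[OF k, of "Suc k"] by linarith
  moreover have "H l (q l) = 0" using H_on[of l "q l" l] h_q \<epsilon> by simp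
  then have "H l p < \<epsilon>/4" using N_H[OF l(2), of l] by linarith
  ultimately show False using H_mono[OF l(1), of p] by linarith
qed

theorem equicontinuous_on_minimal:
  fixes G :: "('g, 'm) monoid_scheme" and f :: "'y \<Rightarrow> real"
  assumes cap: "CAP TYPE('g \<Rightarrow> real) G T"
    and M: "compact_action G T M \<phi>" and Y: "compact_action G T Y \<psi>"
    and minimal: "\<And>x. x \<in> topspace M \<Longrightarrow> orbcl M \<phi> (carrier G) x = topspace M"
    and cont: "\<And>F. F \<in> \<Phi> \<Longrightarrow> continuous_map M Y F"
    and equiv: "\<And>F g x. F \<in> \<Phi> \<Longrightarrow> g \<in> carrier G \<Longrightarrow> x \<in> topspace M \<Longrightarrow> F (\<phi> g x) = \<psi> g (F x)"
    and f: "continuous_map Y euclideanreal f"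
    and \<delta>: "\<delta> > 0" and p: "p \<in> topspace M"
  shows "\<exists>V. openin M V \<and> p \<in> V \<and> (\<forall>F\<in>\<Phi>. \<forall>q\<in>V. \<bar>f (F q) - f (F p)\<bar> < \<delta>)"
proof (rule small_oscillation_imp_equicontinuous[OF cap M Y minimal cont equiv f _ _ p, where \<epsilon> = "\<delta>/2"])
  show "\<exists>W. openin M W \<and> W \<noteq> {} \<and> W \<subseteq> V \<and> (\<forall>F\<in>\<Phi>. \<forall>a\<in>W. \<forall>b\<in>W. \<bar>f (F a) - f (F b)\<bar> \<le> \<delta>/2)"
    if "openin M V" "V \<noteq> {}" for V
    by (rule ex_small_oscillation[OF cap M Y minimal cont equiv f _ that]) (use \<delta> in auto)
qed (use \<delta> in auto)

section \<open>Commuting families and normal subgroups\<close>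

text \<open>Let \<open>C = cl (G x)\<close>, a minimal flow. If \<open>z\<close> is a limit of points \<open>h g x\<close>, then along a subnet \<open>g x\<close>
tends to some \<open>m \<in> C\<close>, and \<open>z\<close> is also the limit of the points \<open>h m\<close>, because the maps \<open>h\<close> are
equivariant and hence equicontinuous on \<open>C\<close>. Thus \<open>z \<in> cl (H m)\<close>. By almost periodicity \<open>m \<in> cl (H z)\<close> and
\<open>x \<in> cl (G m)\<close>, so that \<open>x\<close> lies in the joint orbit closure of \<open>z\<close>.\<close>

lemma almost_periodic_commuting:
  fixes G :: "('g, 'm) monoid_scheme"
  assumes cap: "CAP TYPE('g \<Rightarrow> real) G T"
    and X: "compact_action G T X \<psi>" and H: "monoid_action X \<theta> S"
    and commute: "\<And>h g x. h \<in> S \<Longrightarrow> g \<in> carrier G \<Longrightarrow> x \<in> topspace X \<Longrightarrow> \<theta> h (\<psi> g x) = \<psi> g (\<theta> h x)"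
    and apG: "\<And>x. x \<in> topspace X \<Longrightarrow> almost_periodic X \<psi> (carrier G) x"
    and apH: "\<And>x. x \<in> topspace X \<Longrightarrow> almost_periodic X \<theta> S x"
    and x: "x \<in> topspace X"
  shows "almost_periodic X (\<lambda>(h, g) x. \<theta> h (\<psi> g x)) (S \<times> carrier G) x"
proof -
  let ?K = "carrier G" and ?\<theta> = "\<lambda>(h, g) x. \<theta> h (\<psi> g x)"
  interpret X: compact_action G T X \<psi> by (rule X)
  interpret H: monoid_action X \<theta> S by (rule H)
  interpret HG: monoid_action X ?\<theta> "S \<times> ?K"
  proof
    show "continuous_map X X (?\<theta> s)" if "s \<in> S \<times> ?K" for s
      using that continuous_map_compose[OF X.act_continuous H.act_continuous]
      by (auto simp: o_def)
    show "\<exists>r\<in>S \<times> ?K. \<forall>x\<in>topspace X. ?\<theta> s (?\<theta> t x) = ?\<theta> r x"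
      if s: "s \<in> S \<times> ?K" and t: "t \<in> S \<times> ?K" for s t
    proof -
      obtain h g h' g' where st: "s = (h, g)" "t = (h', g')" "h \<in> S" "g \<in> ?K" "h' \<in> S" "g' \<in> ?K"
        using s t by auto
      obtain k where k: "k \<in> S" "\<And>x. x \<in> topspace X \<Longrightarrow> \<theta> h (\<theta> h' x) = \<theta> k x"
        using H.act_compose[OF st(3,5)] by blast
      have "?\<theta> s (?\<theta> t y) = ?\<theta> (k, g \<otimes>\<^bsub>G\<^esub> g') y" if "y \<in> topspace X" for y
        using st that k X.act_in commute[OF st(5,4), symmetric] by (simp add: X.act_mult)
      then show ?thesis using k(1) st by (intro bexI[of _ "(k, g \<otimes>\<^bsub>G\<^esub> g')"]) auto
    qed
    show "\<exists>e\<in>S \<times> ?K. \<forall>x\<in>topspace X. ?\<theta> e x = x"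
      using H.act_identity X.act_identity by force
  qed
  define C where "C = orbcl X \<psi> ?K x"
  have C: "closedin X C" "C \<subseteq> topspace X" "\<And>g y. g \<in> ?K \<Longrightarrow> y \<in> C \<Longrightarrow> \<psi> g y \<in> C"
    using orbcl_in_topspace[of X \<psi> ?K x] X.orbcl_invariant[OF x] by (auto simp: C_def)
  let ?M = "subtopology X C"
  have M: "compact_action G T ?M \<psi>" by (rule X.subspace[OF C(1,3)])
  interpret M: compact_action G T ?M \<psi> by (rule M)
  have topM: "topspace ?M = C" using C(2) by auto
  have minimal: "orbcl ?M \<psi> ?K y = topspace ?M" if "y \<in> topspace ?M" for y
  proof -
    have y: "y \<in> C" "y \<in> topspace X" using that topM C(2) by auto
    then have "x \<in> orbcl X \<psi> ?K y" using apG[OF x] by (simp add: almost_periodic_def C_def)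
    then have "orbcl X \<psi> ?K y = C"
      using X.orbcl_trans[OF x, of y] X.orbcl_trans[OF y(2), of x] y(1) by (auto simp: C_def)
    then show ?thesis using C y(1) topM by (simp add: orbcl_subspace)
  qed
  have "x \<in> orbcl X ?\<theta> (S \<times> ?K) z" if z: "z \<in> orbcl X ?\<theta> (S \<times> ?K) x" for z
  proof -
    have zt: "z \<in> topspace X" using z orbcl_in_topspace by fastforce
    let ?P = "prod_topology ?M X"
    define B where "B = (\<lambda>(h, g). (\<psi> g x, \<theta> h (\<psi> g x))) ` (S \<times> ?K)"
    have "closed_map ?P X snd"
      using M.compact X.compact X.Hausdorff
      by (intro continuous_imp_closed_map continuous_map_snd) (simp_all add: compact_space_prod_topology)
    moreover have "B \<subseteq> topspace ?P"
      using C(2) X.orbit_subset_orbcl[OF x] H.act_in X.act_in x topM by (auto simp: B_def C_def)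
    ultimately have "X closure_of (snd ` B) \<subseteq> snd ` (?P closure_of B)"
      using closed_map_closure_of_image by metis
    moreover have "snd ` B = (\<lambda>s. ?\<theta> s x) ` (S \<times> ?K)"
      by (simp add: B_def image_image case_prod_unfold)
    ultimately have "z \<in> snd ` (?P closure_of B)" using z unfolding orbcl_def by auto
    then obtain m where m: "(m, z) \<in> ?P closure_of B" by auto
    then have mC: "m \<in> C" using closure_of_subset_topspace[of ?P B] topM by auto
    have mt: "m \<in> topspace X" using mC C(2) by blast
    \<comment> \<open>A Urysohn function separating \<open>z\<close> from \<open>cl (H m)\<close> reduces the claim to one real function.\<close>
    have "z \<in> orbcl X \<theta> S m"
    proof (rule ccontr)
      assume nz: "z \<notin> orbcl X \<theta> S m"
      have "normal_space X" "closedin X {z}"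
        using X.compact X.Hausdorff zt
        by (auto simp: compact_Hausdorff_or_regular_imp_normal_space closedin_Hausdorff_singleton)
      then obtain f where f: "continuous_map X euclideanreal f"
        "f ` orbcl X \<theta> S m \<subseteq> {0}" "f ` {z} \<subseteq> {1}"
        using Urysohn_lemma_alt[of X "orbcl X \<theta> S m" "{z}" 0 1] nz by (auto simp: disjnt_def)
      have "\<exists>V. openin ?M V \<and> m \<in> V \<and> (\<forall>F\<in>\<theta> ` S. \<forall>q\<in>V. \<bar>f (F q) - f (F m)\<bar> < 1/2)"
      proof (rule equicontinuous_on_minimal[OF cap M X minimal _ _ f(1)])
        show "continuous_map ?M X F" if "F \<in> \<theta> ` S" for F
          using that H.act_continuous continuous_map_from_subtopology by blast
      qed (use commute mC topM in auto)
      then obtain V where V: "openin ?M V" "m \<in> V"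
        "\<And>h q. h \<in> S \<Longrightarrow> q \<in> V \<Longrightarrow> \<bar>f (\<theta> h q) - f (\<theta> h m)\<bar> < 1/2" by blast
      let ?N = "{y \<in> topspace X. f y \<in> {1/2<..}}"
      have "openin X ?N" by (rule openin_continuous_map_preimage[OF f(1)]) simp
      then have "openin ?P (V \<times> ?N)" "(m, z) \<in> V \<times> ?N"
        using V zt f(3) by (auto simp: openin_prod_Times_iff)
      then obtain c where c: "c \<in> B" "c \<in> V \<times> ?N" using m unfolding in_closure_of by meson
      then obtain h q where "h \<in> S" "q \<in> V" "1/2 < f (\<theta> h q)" by (auto simp: B_def)
      moreover have "f (\<theta> h m) = 0"
        using f(2) H.orbit_subset_orbcl[OF mt \<open>h \<in> S\<close>] by blast
      ultimately show False using V(3)[of h q] by simp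
    qed
    then have "m \<in> orbcl X \<theta> S z" using apH[OF mt] by (simp add: almost_periodic_def)
    moreover have "orbcl X \<theta> S z \<subseteq> orbcl X ?\<theta> (S \<times> ?K) z"
    proof (rule orbcl_least)
      show "\<theta> h z \<in> orbcl X ?\<theta> (S \<times> ?K) z" if "h \<in> S" for h
        using HG.orbit_subset_orbcl[OF zt, of "(h, \<one>\<^bsub>G\<^esub>)"] that zt by (simp add: X.act_one)
    qed simp
    ultimately have m_in: "m \<in> orbcl X ?\<theta> (S \<times> ?K) z" by blast
    have "orbcl X \<psi> ?K m \<subseteq> orbcl X ?\<theta> (S \<times> ?K) z"
    proof (rule orbcl_least)
      obtain e where e: "e \<in> S" "\<And>y. y \<in> topspace X \<Longrightarrow> \<theta> e y = y" using H.act_identity by blast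
      show "\<psi> g m \<in> orbcl X ?\<theta> (S \<times> ?K) z" if "g \<in> ?K" for g
        using HG.orbcl_invariant[OF zt m_in, of "(e, g)"] that e X.act_in[OF that mt] by simp
    qed simp
    moreover have "x \<in> orbcl X \<psi> ?K m"
      using apG[OF x] mC by (simp add: almost_periodic_def C_def)
    ultimately show ?thesis by blast
  qed
  then show ?thesis using x by (simp add: almost_periodic_def)
qed

text \<open>The minimal set \<open>cl (G x)\<close> contains some point that is almost periodic for the normal family. The
elements of \<open>G\<close> permute such points, and they form a closed set, so the orbit closure of that point,
which is all of \<open>cl (G x)\<close>, consists of them.\<close>

lemma (in compact_action) almost_periodic_normal:
  assumes N: "monoid_action X \<psi> S"
    and closed: "closedin X {x. almost_periodic X \<psi> S x}"
    and normal: "\<And>g x. g \<in> carrier G \<Longrightarrow> x \<in> topspace X \<Longrightarrow>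
          \<phi> g ` (\<lambda>s. \<psi> s x) ` S = (\<lambda>s. \<psi> s (\<phi> g x)) ` S"
    and sub: "\<And>s. s \<in> S \<Longrightarrow> \<exists>g \<in> carrier G. \<forall>x \<in> topspace X. \<psi> s x = \<phi> g x"
    and ap: "almost_periodic X \<phi> (carrier G) x"
  shows "almost_periodic X \<psi> S x"
proof -
  interpret N: monoid_action X \<psi> S by (rule N)
  have x: "x \<in> topspace X" using ap by (simp add: almost_periodic_def)
  let ?C = "orbcl X \<phi> (carrier G) x"
  have "\<exists>y \<in> ?C. almost_periodic X \<psi> S y"
  proof (rule N.almost_periodic_exists[OF compact])
    show "?C \<noteq> {}" using orbcl_self[OF x] by blast
    show "\<psi> s y \<in> ?C" if "s \<in> S" "y \<in> ?C" for s y
      using sub[OF that(1)] orbcl_invariant[OF x that(2)] that(2) orbcl_in_topspace by (metis subsetD)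
  qed simp
  then obtain y where y: "y \<in> ?C" "almost_periodic X \<psi> S y" by blast
  have "almost_periodic X \<psi> S (\<phi> g y)" if g: "g \<in> carrier G" for g
    by (rule almost_periodic_image[OF compact Hausdorff act_continuous[OF g] N.act_in normal[OF g] y(2)])
  then have "orbcl X \<phi> (carrier G) y \<subseteq> {x. almost_periodic X \<psi> S x}"
    by (intro orbcl_least closed) simp
  moreover have "x \<in> orbcl X \<phi> (carrier G) y" using ap y(1) by (simp add: almost_periodic_def)
  ultimately show ?thesis by blast
qed

lemma almost_periodic_subspace:
  assumes Y: "closedin X Y" and inv: "\<And>s y. s \<in> S \<Longrightarrow> y \<in> Y \<Longrightarrow> \<phi> s y \<in> Y" and x: "x \<in> Y"
  shows "almost_periodic (subtopology X Y) \<phi> S x \<longleftrightarrow> almost_periodic X \<phi> S x"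
proof -
  have "orbcl (subtopology X Y) \<phi> S y = orbcl X \<phi> S y" if "y \<in> Y" for y
    by (rule orbcl_subspace[OF Y]) (use inv that in auto)
  then have "(\<forall>z\<in>orbcl X \<phi> S x. x \<in> orbcl (subtopology X Y) \<phi> S z) \<longleftrightarrow>
      (\<forall>z\<in>orbcl X \<phi> S x. x \<in> orbcl X \<phi> S z)" "orbcl (subtopology X Y) \<phi> S x = orbcl X \<phi> S x"
    using orbcl_least[OF Y, of S \<phi> x] inv x by (auto intro!: ball_cong)
  then show ?thesis
    using x closedin_subset[OF Y] by (auto simp: almost_periodic_def)
qed

section \<open>Flows of product groups\<close>

lemma topological_group_product:
  assumes "\<And>i. i \<in> I \<Longrightarrow> topological_group (G i) (T i)"
  shows "topological_group (product_group I G) (product_topology T I)"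
proof -
  have gr: "group (G i)" and topT: "topspace (T i) = carrier (G i)" and haus: "Hausdorff_space (T i)"
    and mult: "continuous_map (prod_topology (T i) (T i)) (T i) (\<lambda>(g, h). g \<otimes>\<^bsub>G i\<^esub> h)"
    and inv: "continuous_map (T i) (T i) (\<lambda>g. inv\<^bsub>G i\<^esub> g)" if "i \<in> I" for i
    using assms[OF that] by (auto simp: topological_group_def)
  let ?T = "product_topology T I"
  have top: "topspace ?T = (\<Pi>\<^sub>E i\<in>I. carrier (G i))"
    using topT by (auto intro: PiE_cong)
  have "continuous_map (prod_topology ?T ?T) (T i) (\<lambda>p. fst p i \<otimes>\<^bsub>G i\<^esub> snd p i)" if "i \<in> I" for i
  proof -
    have "continuous_map (prod_topology ?T ?T) (prod_topology (T i) (T i)) (\<lambda>p. (fst p i, snd p i))"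
      using continuous_map_compose[OF continuous_map_fst continuous_map_product_projection[OF that]]
        continuous_map_compose[OF continuous_map_snd continuous_map_product_projection[OF that]]
      unfolding continuous_map_paired o_def by blast
    from continuous_map_compose[OF this mult[OF that]] show ?thesis by (simp add: o_def)
  qed
  then have "continuous_map (prod_topology ?T ?T) ?T (\<lambda>p. \<lambda>i\<in>I. fst p i \<otimes>\<^bsub>G i\<^esub> snd p i)"
    unfolding continuous_map_componentwise by auto
  moreover have "continuous_map ?T ?T (\<lambda>g. inv\<^bsub>product_group I G\<^esub> g)"
  proof (rule continuous_map_eq)
    have "continuous_map ?T (T i) (\<lambda>g. inv\<^bsub>G i\<^esub> (g i))" if "i \<in> I" for i
      using continuous_map_compose[OF continuous_map_product_projection[OF that, of T] inv[OF that]]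
      by (simp add: o_def)
    then show "continuous_map ?T ?T (\<lambda>g. \<lambda>i\<in>I. inv\<^bsub>G i\<^esub> g i)"
      unfolding continuous_map_componentwise by auto
    show "(\<lambda>i\<in>I. inv\<^bsub>G i\<^esub> g i) = inv\<^bsub>product_group I G\<^esub> g" if "g \<in> topspace ?T" for g
      using that gr top by simp
  qed
  ultimately show ?thesis
    using gr haus top
    by (auto simp: topological_group_def Hausdorff_space_product_topology case_prod_unfold)
qed

locale product_action = compact_action "product_group I G" "product_topology T I" X \<phi>
  for I :: "'i set" and G :: "'i \<Rightarrow> ('g, 'm) monoid_scheme" and T :: "'i \<Rightarrow> 'g topology"
    and X :: "'x topology" and \<phi> :: "('i \<Rightarrow> 'g) \<Rightarrow> 'x \<Rightarrow> 'x" +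
  assumes factor: "\<And>i. i \<in> I \<Longrightarrow> topological_group (G i) (T i)"
begin

lemma factor_group: "i \<in> I \<Longrightarrow> group (G i)"
  and factor_topspace: "i \<in> I \<Longrightarrow> topspace (T i) = carrier (G i)"
  using factor by (auto simp: topological_group_def)

definition embed :: "'i \<Rightarrow> 'g \<Rightarrow> 'i \<Rightarrow> 'g" where
  "embed i a = (\<lambda>j\<in>I. if j = i then a else \<one>\<^bsub>G j\<^esub>)"

definition supported :: "'i set \<Rightarrow> ('i \<Rightarrow> 'g) set" where
  "supported J = {g \<in> carrier (product_group I G). \<forall>j \<in> I - J. g j = \<one>\<^bsub>G j\<^esub>}"

lemma one_in_factor: "i \<in> I \<Longrightarrow> \<one>\<^bsub>G i\<^esub> \<in> carrier (G i)"
  using factor_group group.is_monoid monoid.one_closed by blast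

lemma embed_in: "i \<in> I \<Longrightarrow> a \<in> carrier (G i) \<Longrightarrow> embed i a \<in> carrier (product_group I G)"
  using one_in_factor by (auto simp: embed_def)

lemma factor_action:
  assumes i: "i \<in> I"
  shows "compact_action (G i) (T i) X (\<lambda>a. \<phi> (embed i a))"
proof
  interpret Gi: group "G i" by (rule factor_group[OF i])
  have "continuous_map (prod_topology (T i) X) (T j) (\<lambda>p. if j = i then fst p else \<one>\<^bsub>G j\<^esub>)"
    if "j \<in> I" for j
    using that one_in_factor factor_topspace continuous_map_fst[of "T i" X] by (cases "j = i") auto
  then have "continuous_map (prod_topology (T i) X) (prod_topology (product_topology T I) X)
      (\<lambda>p. (embed i (fst p), snd p))"
    unfolding continuous_map_paired continuous_map_componentwise embed_def
    using continuous_map_snd by auto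
  from continuous_map_compose[OF this jointly_continuous]
  show "continuous_map (prod_topology (T i) X) X (\<lambda>(a, x). \<phi> (embed i a) x)"
    by (simp add: o_def case_prod_unfold)
  show "\<phi> (embed i (a \<otimes>\<^bsub>G i\<^esub> b)) x = \<phi> (embed i a) (\<phi> (embed i b) x)"
    if "a \<in> carrier (G i)" "b \<in> carrier (G i)" "x \<in> topspace X" for a b x
  proof -
    have "embed i (a \<otimes>\<^bsub>G i\<^esub> b) = embed i a \<otimes>\<^bsub>product_group I G\<^esub> embed i b"
      using factor_group by (auto simp: embed_def group.is_monoid monoid.l_one one_in_factor)
    then show ?thesis using that embed_in[OF i] by (simp only: act_mult)
  qed
  have "embed i \<one>\<^bsub>G i\<^esub> = \<one>\<^bsub>product_group I G\<^esub>" by (auto simp: embed_def)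
  then show "\<phi> (embed i \<one>\<^bsub>G i\<^esub>) x = x" if "x \<in> topspace X" for x
    using act_one[OF that] by (simp only:)
qed (use factor[OF i] compact Hausdorff in auto)

lemma supported_mult:
  "g \<in> supported J \<Longrightarrow> h \<in> supported J \<Longrightarrow> g \<otimes>\<^bsub>product_group I G\<^esub> h \<in> supported J"
  using factor_group
  by (auto simp: supported_def PiE_iff group.is_monoid monoid.m_closed monoid.l_one one_in_factor)

lemma supported_action: "monoid_action X \<phi> (supported J)"
proof
  have sub: "supported J \<subseteq> carrier (product_group I G)" unfolding supported_def by blast
  show "continuous_map X X (\<phi> g)" if "g \<in> supported J" for g
    using act_continuous that sub by blast
  show "\<exists>r\<in>supported J. \<forall>x\<in>topspace X. \<phi> g (\<phi> h x) = \<phi> r x"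
    if "g \<in> supported J" "h \<in> supported J" for g h
    using supported_mult[OF that] act_mult that sub by (metis subsetD)
  have "\<one>\<^bsub>product_group I G\<^esub> \<in> supported J"
    using one_in_factor by (auto simp: supported_def)
  then show "\<exists>e\<in>supported J. \<forall>x\<in>topspace X. \<phi> e x = x"
    using act_one by blast
qed

lemma embed_conjugate:
  assumes i: "i \<in> I" and g: "g \<in> carrier (product_group I G)" and a: "a \<in> carrier (G i)"
  shows "g \<otimes>\<^bsub>product_group I G\<^esub> embed i a =
    embed i (g i \<otimes>\<^bsub>G i\<^esub> a \<otimes>\<^bsub>G i\<^esub> inv\<^bsub>G i\<^esub> (g i)) \<otimes>\<^bsub>product_group I G\<^esub> g"
proof -
  have gi: "g j \<in> carrier (G j)" if "j \<in> I" for j using g that by auto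
  interpret Gi: group "G i" by (rule factor_group[OF i])
  have "g i \<otimes>\<^bsub>G i\<^esub> a = g i \<otimes>\<^bsub>G i\<^esub> a \<otimes>\<^bsub>G i\<^esub> inv\<^bsub>G i\<^esub> (g i) \<otimes>\<^bsub>G i\<^esub> g i"
    using gi[OF i] a by (simp add: Gi.m_assoc)
  then show ?thesis
    using gi factor_group
    by (auto simp: embed_def group.is_monoid monoid.l_one monoid.r_one intro!: restrict_ext)
qed

lemma factor_almost_periodic:
  assumes i: "i \<in> I" and cap: "CAP TYPE('g \<Rightarrow> real) (G i) (T i)"
    and ap: "almost_periodic X \<phi> (carrier (product_group I G)) x"
  shows "almost_periodic X (\<lambda>a. \<phi> (embed i a)) (carrier (G i)) x"
proof -
  interpret Gi: compact_action "G i" "T i" X "\<lambda>a. \<phi> (embed i a)" by (rule factor_action[OF i])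
  show ?thesis
  proof (rule almost_periodic_normal[OF Gi.monoid_action_axioms Gi.closedin_almost_periodic[OF cap] _ _ ap])
    fix g x assume g: "g \<in> carrier (product_group I G)" and x: "x \<in> topspace X"
    have gi: "g i \<in> carrier (G i)" using g i by auto
    have conj: "\<phi> g (\<phi> (embed i a) x) = \<phi> (embed i (g i \<otimes>\<^bsub>G i\<^esub> a \<otimes>\<^bsub>G i\<^esub> inv\<^bsub>G i\<^esub> (g i))) (\<phi> g x)"
      if a: "a \<in> carrier (G i)" for a
      using embed_conjugate[OF i g a] act_mult[OF g embed_in[OF i a] x]
        act_mult[OF embed_in[OF i] g x] gi a by (metis Gi.inv_closed Gi.m_closed)
    show "\<phi> g ` (\<lambda>a. \<phi> (embed i a) x) ` carrier (G i) = (\<lambda>a. \<phi> (embed i a) (\<phi> g x)) ` carrier (G i)"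
    proof (intro subset_antisym subsetI)
      fix y assume "y \<in> \<phi> g ` (\<lambda>a. \<phi> (embed i a) x) ` carrier (G i)"
      then obtain a where "a \<in> carrier (G i)" "y = \<phi> g (\<phi> (embed i a) x)" by blast
      then show "y \<in> (\<lambda>a. \<phi> (embed i a) (\<phi> g x)) ` carrier (G i)" using conj gi by auto
    next
      fix y assume "y \<in> (\<lambda>a. \<phi> (embed i a) (\<phi> g x)) ` carrier (G i)"
      then obtain b where b: "b \<in> carrier (G i)" "y = \<phi> (embed i b) (\<phi> g x)" by blast
      let ?a = "inv\<^bsub>G i\<^esub> (g i) \<otimes>\<^bsub>G i\<^esub> b \<otimes>\<^bsub>G i\<^esub> g i"
      have "g i \<otimes>\<^bsub>G i\<^esub> ?a \<otimes>\<^bsub>G i\<^esub> inv\<^bsub>G i\<^esub> (g i) = b"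
        using gi b by (simp add: Gi.m_assoc) (simp flip: Gi.m_assoc)
      moreover have a: "?a \<in> carrier (G i)" using gi b by simp
      ultimately have "y = \<phi> g (\<phi> (embed i ?a) x)" using conj[OF a] b(2) by simp
      then show "y \<in> \<phi> g ` (\<lambda>a. \<phi> (embed i a) x) ` carrier (G i)" using a by blast
    qed
  qed (use embed_in[OF i] in blast)
qed

text \<open>Elements supported in \<open>insert i J\<close> are the products of an element supported in \<open>J\<close> and one of the
\<open>i\<close>-th factor, and these commute; so the commuting lemma gives the induction step.\<close>

lemma finite_support_almost_periodic:
  assumes cap: "\<And>i. i \<in> I \<Longrightarrow> CAP TYPE('g \<Rightarrow> real) (G i) (T i)"
    and ap: "\<And>i x. i \<in> I \<Longrightarrow> x \<in> topspace X \<Longrightarrow>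
          almost_periodic X (\<lambda>a. \<phi> (embed i a)) (carrier (G i)) x"
    and J: "finite J" "J \<subseteq> I" and x: "x \<in> topspace X"
  shows "almost_periodic X \<phi> (supported J) x"
  using J x
proof (induction J arbitrary: x rule: finite_induct)
  case empty
  have "supported {} = {\<one>\<^bsub>product_group I G\<^esub>}"
    using one_in_factor by (auto simp: supported_def PiE_iff extensional_def)
  then have "orbcl X \<phi> (supported {}) y = {y}" if "y \<in> topspace X" for y
    using that act_one[OF that] Hausdorff
    by (simp add: orbcl_def closure_of_closedin closedin_Hausdorff_singleton del: one_product_group)
  then show ?case using empty by (simp add: almost_periodic_def)
next
  case (insert i J)
  have i: "i \<in> I" using insert.prems by simp
  interpret Gi: compact_action "G i" "T i" X "\<lambda>a. \<phi> (embed i a)" by (rule factor_action[OF i])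
  have supp: "h \<in> carrier (product_group I G)" "h i = \<one>\<^bsub>G i\<^esub>" if "h \<in> supported J" for h
    using that i insert.hyps(2) by (auto simp: supported_def)
  have "almost_periodic X (\<lambda>(h, a) x. \<phi> h (\<phi> (embed i a) x)) (supported J \<times> carrier (G i)) x"
  proof (rule almost_periodic_commuting[OF cap[OF i] Gi.compact_action_axioms supported_action])
    fix h a y assume h: "h \<in> supported J" and a: "a \<in> carrier (G i)" and y: "y \<in> topspace X"
    have "h \<otimes>\<^bsub>product_group I G\<^esub> embed i a = embed i a \<otimes>\<^bsub>product_group I G\<^esub> h"
      using embed_conjugate[OF i supp(1)[OF h] a] a by (simp only: supp(2)[OF h] Gi.l_one Gi.r_one Gi.inv_one)
    then show "\<phi> h (\<phi> (embed i a) y) = \<phi> (embed i a) (\<phi> h y)"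
      using act_mult[OF supp(1)[OF h] embed_in[OF i a] y] act_mult[OF embed_in[OF i a] supp(1)[OF h] y]
      by simp
  qed (use ap i insert in auto)
  moreover have "(\<lambda>s. (\<lambda>(h, a) x. \<phi> h (\<phi> (embed i a) x)) s y) ` (supported J \<times> carrier (G i)) =
      (\<lambda>g. \<phi> g y) ` supported (insert i J)" if y: "y \<in> topspace X" for y
  proof (intro subset_antisym subsetI)
    fix z assume "z \<in> (\<lambda>s. (\<lambda>(h, a) x. \<phi> h (\<phi> (embed i a) x)) s y) ` (supported J \<times> carrier (G i))"
    then obtain h a where ha: "h \<in> supported J" "a \<in> carrier (G i)" "z = \<phi> h (\<phi> (embed i a) y)" by auto
    have "h \<in> supported (insert i J)" using ha(1) by (auto simp: supported_def)
    moreover have "embed i a \<in> supported (insert i J)"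
      using embed_in[OF i ha(2)] by (auto simp: supported_def embed_def)
    ultimately have "h \<otimes>\<^bsub>product_group I G\<^esub> embed i a \<in> supported (insert i J)" by (rule supported_mult)
    moreover have "z = \<phi> (h \<otimes>\<^bsub>product_group I G\<^esub> embed i a) y"
      using ha(3) act_mult[OF supp(1)[OF ha(1)] embed_in[OF i ha(2)] y] by (simp only:)
    ultimately show "z \<in> (\<lambda>g. \<phi> g y) ` supported (insert i J)" by blast
  next
    fix z assume "z \<in> (\<lambda>g. \<phi> g y) ` supported (insert i J)"
    then obtain g where g: "g \<in> supported (insert i J)" "z = \<phi> g y" by blast
    define h where "h = (\<lambda>j\<in>I. if j = i then \<one>\<^bsub>G j\<^esub> else g j)"
    have gc: "g \<in> carrier (product_group I G)" and gi: "\<And>j. j \<in> I \<Longrightarrow> g j \<in> carrier (G j)"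
      using g(1) by (auto simp: supported_def)
    have h: "h \<in> supported J"
      using g(1) gi one_in_factor by (auto simp: supported_def h_def)
    have "h \<otimes>\<^bsub>product_group I G\<^esub> embed i (g i) = g"
      using gc gi factor_group
      by (intro extensionalityI[of _ I])
        (auto simp: h_def embed_def group.is_monoid monoid.l_one monoid.r_one PiE_iff)
    then have "z = \<phi> h (\<phi> (embed i (g i)) y)"
      using g(2) act_mult[OF supp(1)[OF h] embed_in[OF i gi[OF i]] y] by (simp only:)
    then show "z \<in> (\<lambda>s. (\<lambda>(h, a) x. \<phi> h (\<phi> (embed i a) x)) s y) ` (supported J \<times> carrier (G i))"
      using h gi[OF i] by (auto intro!: image_eqI[of _ _ "(h, g i)"])
  qed
  then have "orbcl X (\<lambda>(h, a) x. \<phi> h (\<phi> (embed i a) x)) (supported J \<times> carrier (G i)) y =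
      orbcl X \<phi> (supported (insert i J)) y" if "y \<in> topspace X" for y
    using that by (intro orbcl_cong)
  ultimately show ?case
    by (simp only: almost_periodic_cong[of X "\<lambda>(h, a) x. \<phi> h (\<phi> (embed i a) x)" _ \<phi> "supported (insert i J)"])
qed

text \<open>Given a neighbourhood of \<open>x\<close>, choose \<open>J\<close> finite such that elements trivial on \<open>J\<close> move points near
\<open>x\<close> only within that neighbourhood. Almost periodicity for the elements supported in \<open>J\<close> gives a
finite set \<open>L\<close> of them that brings every \<open>h x\<close> with \<open>h\<close> supported in \<open>J\<close> back near \<open>x\<close>. For a general \<open>k\<close>,
write \<open>k = n h\<close> with \<open>n\<close> trivial on \<open>J\<close>; then \<open>g k x = n (g h x)\<close> for \<open>g \<in> L\<close>. So \<open>L\<close> brings the whole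
orbit of \<open>x\<close>, and then its closure, back near \<open>x\<close>.\<close>

lemma almost_periodic_if_finite_support:
  assumes ap: "\<And>J. finite J \<Longrightarrow> J \<subseteq> I \<Longrightarrow> almost_periodic X \<phi> (supported J) x"
  shows "almost_periodic X \<phi> (carrier (product_group I G)) x"
proof -
  let ?K = "carrier (product_group I G)" and ?T = "product_topology T I"
  have x: "x \<in> topspace X" using ap[of "{}"] by (simp add: almost_periodic_def)
  have "x \<in> orbcl X \<phi> ?K z" if z: "z \<in> orbcl X \<phi> ?K x" for z
  proof -
    have zt: "z \<in> topspace X" using z orbcl_in_topspace by fastforce
    have "\<exists>g\<in>?K. \<phi> g z \<in> V" if V: "openin X V" "x \<in> V" for V
    proof -
      \<comment> \<open>A closed neighbourhood \<open>C\<close> inside \<open>V\<close>, so that the return property passes to the closure of the orbit.\<close>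
      have "regular_space X"
        using compact Hausdorff by (simp add: compact_Hausdorff_imp_regular_space)
      then obtain V1 C where V1: "openin X V1" "closedin X C" "x \<in> V1" "V1 \<subseteq> C" "C \<subseteq> V"
        using V x unfolding neighbourhood_base_of_closedin[symmetric] neighbourhood_base_of by metis
      let ?W = "{p \<in> topspace (prod_topology ?T X). (\<lambda>(g, x). \<phi> g x) p \<in> V1}"
      have "openin (prod_topology ?T X) ?W"
        by (rule openin_continuous_map_preimage[OF jointly_continuous V1(1)])
      moreover have "(\<one>\<^bsub>product_group I G\<^esub>, x) \<in> ?W"
        using x V1(3) act_one[OF x] one_closed topspace_group by (simp del: one_product_group)
      ultimately obtain U V2 where U: "openin ?T U" "openin X V2" "\<one>\<^bsub>product_group I G\<^esub> \<in> U" "x \<in> V2"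
        "U \<times> V2 \<subseteq> ?W"
        unfolding openin_prod_topology_alt by meson
      obtain N where N: "finite {i \<in> I. N i \<noteq> topspace (T i)}" "\<And>i. i \<in> I \<Longrightarrow> openin (T i) (N i)"
        "\<one>\<^bsub>product_group I G\<^esub> \<in> Pi\<^sub>E I N" "Pi\<^sub>E I N \<subseteq> U"
        using U(1,3) unfolding openin_product_topology_alt by meson
      define J where "J = {i \<in> I. N i \<noteq> topspace (T i)}"
      have J: "finite J" "J \<subseteq> I" using N(1) by (auto simp: J_def)
      interpret S: monoid_action X \<phi> "supported J" by (rule supported_action)
      have SK: "supported J \<subseteq> ?K" unfolding supported_def by blast
      define E where "E g = {y \<in> topspace X. \<phi> g y \<in> V2}" for g
      have open_E: "openin X (E g)" if "g \<in> supported J" for g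
        unfolding E_def using openin_continuous_map_preimage S.act_continuous that U(2) by blast
      have "orbcl X \<phi> (supported J) x \<subseteq> \<Union>(E ` supported J)"
      proof
        fix y assume y: "y \<in> orbcl X \<phi> (supported J) x"
        then have "x \<in> orbcl X \<phi> (supported J) y" using ap[OF J] by (simp add: almost_periodic_def)
        then have "\<exists>v. v \<in> (\<lambda>g. \<phi> g y) ` supported J \<and> v \<in> V2"
          using U(2,4) unfolding orbcl_def in_closure_of by blast
        moreover have "y \<in> topspace X" using y orbcl_in_topspace by fastforce
        ultimately show "y \<in> \<Union>(E ` supported J)" by (auto simp: E_def)
      qed
      moreover have "compactin X (orbcl X \<phi> (supported J) x)"
        using compact by (simp add: closedin_compact_space)
      ultimately obtain \<F> where \<F>: "finite \<F>" "\<F> \<subseteq> E ` supported J" "orbcl X \<phi> (supported J) x \<subseteq> \<Union>\<F>"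
        using compactinD[of X "orbcl X \<phi> (supported J) x" "E ` supported J"] open_E by blast
      then obtain L where L: "finite L" "L \<subseteq> supported J" "orbcl X \<phi> (supported J) x \<subseteq> \<Union>(E ` L)"
        using finite_subset_image[OF \<F>(1,2)] by auto
      let ?D = "\<Union>g\<in>L. {y \<in> topspace X. \<phi> g y \<in> C}"
      have "closedin X ?D"
        using L(1,2) closedin_continuous_map_preimage[OF S.act_continuous V1(2)]
        by (intro closedin_Union) auto
      moreover have "\<phi> k x \<in> ?D" if k: "k \<in> ?K" for k
      proof -
        define h where "h = (\<lambda>i\<in>I. if i \<in> J then k i else \<one>\<^bsub>G i\<^esub>)"
        define n where "n = (\<lambda>i\<in>I. if i \<in> J then \<one>\<^bsub>G i\<^esub> else k i)"
        have ki: "k i \<in> carrier (G i)" if "i \<in> I" for i using k that by auto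
        have h: "h \<in> supported J" using ki one_in_factor by (auto simp: h_def supported_def)
        have nK: "n \<in> ?K" using ki one_in_factor by (auto simp: n_def)
        have "n \<in> Pi\<^sub>E I N"
          using N(3) ki factor_topspace by (auto simp: n_def J_def PiE_iff)
        then have nU: "n \<in> U" using N(4) by blast
        have "\<phi> h x \<in> orbcl X \<phi> (supported J) x" by (rule S.orbit_subset_orbcl[OF x h])
        then obtain g where g: "g \<in> L" "\<phi> g (\<phi> h x) \<in> V2" using L(3) by (auto simp: E_def)
        then have gS: "g \<in> supported J" "g \<in> ?K" using L(2) SK by auto
        have hK: "h \<in> ?K" using h SK by blast
        have gi: "g i \<in> carrier (G i)" if "i \<in> I" for i using gS(2) that by auto
        have "g \<otimes>\<^bsub>product_group I G\<^esub> k = n \<otimes>\<^bsub>product_group I G\<^esub> (g \<otimes>\<^bsub>product_group I G\<^esub> h)"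
          using gS(1) ki gi factor_group
          by (auto simp: supported_def n_def h_def group.is_monoid monoid.l_one monoid.r_one
              monoid.m_closed intro!: restrict_ext)
        then have "\<phi> g (\<phi> k x) = \<phi> n (\<phi> g (\<phi> h x))"
          using act_mult x gS(2) k nK hK m_closed act_in by metis
        moreover have "\<phi> n (\<phi> g (\<phi> h x)) \<in> V1" using U(5) nU g(2) by auto
        ultimately have "\<phi> g (\<phi> k x) \<in> C" using V1(4) by auto
        then show ?thesis using g(1) act_in[OF k x] by blast
      qed
      ultimately have "orbcl X \<phi> ?K x \<subseteq> ?D" by (rule orbcl_least)
      then obtain g where "g \<in> L" "\<phi> g z \<in> C" using z by blast
      then show ?thesis using L(2) SK V1(5) by blast
    qed
    then show ?thesis using x unfolding orbcl_def in_closure_of by blast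
  qed
  then show ?thesis using x by (simp add: almost_periodic_def)
qed

end

theorem corollary7p6:
  fixes I :: "'i set"
    and G :: "'i \<Rightarrow> ('g, 'm) monoid_scheme"
    and T :: "'i \<Rightarrow> 'g topology"
  assumes "\<And>i. i \<in> I \<Longrightarrow> CAP TYPE('g \<Rightarrow> real) (G i) (T i)"
  shows "CAP TYPE('x) (product_group I G) (product_topology T I)"
proof -
  let ?G = "product_group I G" and ?T = "product_topology T I"
  have tgi: "topological_group (G i) (T i)" if "i \<in> I" for i using assms[OF that] by (simp add: CAP_def)
  have tg: "topological_group ?G ?T" by (rule topological_group_product[OF tgi])
  have "closedin X (AP ?G X \<phi>)" if fl: "G_flow ?G ?T X \<phi>" for X :: "'x topology" and \<phi>
  proof -
    have "product_action I G T X \<phi>"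
      using compact_action_G_flow[OF fl tg] tgi by (simp add: product_action_def product_action_axioms_def)
    then interpret product_action I G T X \<phi> .
    let ?K = "carrier ?G"
    define A where "A = {x. almost_periodic X \<phi> ?K x}"
    \<comment> \<open>Each factor acts on \<open>Y\<close> with almost periodic points only; the goal is \<open>Y \<subseteq> A\<close>.\<close>
    define Y where "Y = X closure_of A"
    have A_sub: "A \<subseteq> topspace X" by (auto simp: A_def almost_periodic_def)
    have A_inv: "\<phi> g x \<in> A" if g: "g \<in> ?K" and x: "x \<in> A" for g x
    proof -
      have xt: "x \<in> topspace X" using x A_sub by blast
      have "orbcl X \<phi> ?K x \<subseteq> A"
        unfolding A_def
      proof
        fix y assume y: "y \<in> orbcl X \<phi> ?K x"
        have yt: "y \<in> topspace X" using y orbcl_in_topspace by fastforce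
        have xy: "x \<in> orbcl X \<phi> ?K y" using x y by (simp add: A_def almost_periodic_def)
        have "y \<in> orbcl X \<phi> ?K z" if z: "z \<in> orbcl X \<phi> ?K y" for z
        proof -
          have "z \<in> orbcl X \<phi> ?K x" using z orbcl_trans[OF xt y] by blast
          then have "x \<in> orbcl X \<phi> ?K z" using x by (simp add: A_def almost_periodic_def)
          moreover have "z \<in> topspace X" using z orbcl_in_topspace by fastforce
          ultimately show ?thesis using orbcl_trans[of z x] y by blast
        qed
        then show "y \<in> {x. almost_periodic X \<phi> ?K x}" using yt by (simp add: almost_periodic_def)
      qed
      then show ?thesis using orbit_subset_orbcl[OF xt g] by blast
    qed
    have Y: "closedin X Y" "Y \<subseteq> topspace X" "A \<subseteq> Y"
      using closure_of_subset[OF A_sub] by (auto simp: Y_def closure_of_subset_topspace)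
    have Y_inv: "\<phi> g y \<in> Y" if g: "g \<in> ?K" and y: "y \<in> Y" for g y
    proof -
      have "\<phi> g y \<in> X closure_of (\<phi> g ` A)"
        using continuous_map_image_closure_subset[OF act_continuous[OF g]] y unfolding Y_def by blast
      moreover have "\<phi> g ` A \<subseteq> A" using A_inv g by blast
      ultimately show ?thesis unfolding Y_def using closure_of_mono by blast
    qed
    have "product_action I G T (subtopology X Y) \<phi>"
      using subspace[OF Y(1) Y_inv] tgi by (simp add: product_action_def product_action_axioms_def)
    then interpret Y: product_action I G T "subtopology X Y" \<phi> .
    have topY: "topspace (subtopology X Y) = Y" using Y(2) by auto
    have "almost_periodic (subtopology X Y) (\<lambda>a. \<phi> (embed i a)) (carrier (G i)) y"
      if i: "i \<in> I" and y: "y \<in> Y" for i y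
    proof -
      interpret Gi: compact_action "G i" "T i" X "\<lambda>a. \<phi> (embed i a)" by (rule factor_action[OF i])
      have "A \<subseteq> {x. almost_periodic X (\<lambda>a. \<phi> (embed i a)) (carrier (G i)) x}"
        using factor_almost_periodic[OF i assms[OF i]] by (auto simp: A_def)
      then have "Y \<subseteq> {x. almost_periodic X (\<lambda>a. \<phi> (embed i a)) (carrier (G i)) x}"
        unfolding Y_def by (rule closure_of_minimal[OF _ Gi.closedin_almost_periodic[OF assms[OF i]]])
      then show ?thesis
        using almost_periodic_subspace[OF Y(1), of "carrier (G i)" "\<lambda>a. \<phi> (embed i a)" y]
          Y_inv embed_in[OF i] y by blast
    qed
    then have "almost_periodic (subtopology X Y) \<phi> ?K y" if "y \<in> Y" for y
      using that topY assms
      by (intro Y.almost_periodic_if_finite_support Y.finite_support_almost_periodic) simp_all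
    then have "Y \<subseteq> A"
      using almost_periodic_subspace[OF Y(1), of ?K \<phi>] Y_inv unfolding A_def by blast
    then have "closedin X A" using Y by (simp add: subset_antisym)
    then show ?thesis using AP_eq_almost_periodic[OF fl tg] by (simp add: A_def)
  qed
  then show ?thesis using tg by (simp add: CAP_def)
qed

end
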